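(* Suppose there exist constants $l_1,l_2>0$ such that for every $k=1,\dots,m$, $$\|U_k(x)\|\le l_1\quad\text{and}\quad \|U_k(x)-U_k(y)\|\le l_2\|x-y\|\qquad\text{for all }x,y\in\mathbb{R}^n.$$ Then the set of all solutions on $J$ of the impulsive system $$\begin{cases}{}^{C}_{0}D^{\alpha}_t x(t)=-x(t)+P_K\big(x(t)-\rho A x(t)-\rho b\big), & t\in J',\\ x(t_k^+)-x(t_k^-)=U_k(x(t_k)), & k=1,\dots,m,\\ x(0)=x_0,\end{cases}$$ is bounded, i.e. there is a constant $M$ such that $\sup_{t\in J}\|x(t)\|\le M$ for every solution $x$ of this system.
   Context: Setting: $0<\alpha<1$, $T>0$, $J=[0,T]$, impulse times $0=t_0<t_1<\dots<t_m<t_{m+1}=T$, $J'=J\setminus\{t_1,\dots,t_m\}$; $A\in\mathbb{R}^{n\times n}$, $b\in\mathbb{R}^n$, $x_0\in\mathbb{R}^n$ (fixed), $\rho$ a real constant; $K\subset\mathbb{R}^n$ is nonempty, closed and convex, $P_K(y)=\arg\min_{z\in K}\|y-z\|$ is the Euclidean projection onto $K$; $U_k:\mathbb{R}^n\to\mathbb{R}^n$ ($k=1,\dots,m$) are the jump maps. $x(t_k^\pm)$ denote one-sided limits at $t_k$. $\|\cdot\|$ is the Euclidean norm. Caputo derivative of order $\alpha\in(0,1)$: ${}^{C}_{0}D^{\alpha}_t x(t)=\frac{1}{\Gamma(1-\alpha)}\int_0^t (t-s)^{-\alpha}x'(s)\,ds$, where $x'$ is the (a.e. defined) derivative. A function $x:J\to\mathbb{R}^n$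 is a solution of the system on $J$ with $x(0)=x_0$ if (i) $x$ is absolutely continuous on $[0,t_1]$ and on each $(t_k,t_{k+1}]$, $k=1,\dots,m$; (ii) $x$ satisfies the system (the differential equation for almost all $t\in J$, together with the jump conditions and the initial condition); (iii) $x(t_k^-)$ and $x(t_k^+)$ exist with $x(t_k^-)=x(t_k)$ for $k=1,\dots,m$. *)

theory Defs
  imports "HOL-Analysis.Analysis"
begin

text \<open>Absolute continuity of a function on an interval \<open>S\<close> (of any kind) in the usual
  epsilon-delta sense; distinct from the library's absolute continuity of measures.\<close>

definition abs_cont_on :: "real set \<Rightarrow> (real \<Rightarrow> 'a::real_normed_vector) \<Rightarrow> bool" where
  "abs_cont_on S f \<longleftrightarrow>
     (\<forall>\<epsilon>>0. \<exists>\<delta>>0. \<forall>(N::nat) a b.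
        (\<forall>i<N. a i < b i \<and> {a i..b i} \<subseteq> S) \<and>
        disjoint_family_on (\<lambda>i. {a i<..<b i}) {..<N} \<and>
        (\<Sum>i<N. b i - a i) < \<delta>
        \<longrightarrow> (\<Sum>i<N. norm (f (b i) - f (a i))) < \<epsilon>)"

text \<open>The Caputo derivative of order \<open>\<alpha>\<close> with lower limit 0 exists at \<open>t\<close> and equals \<open>D\<close>.
  The derivative of \<open>x\<close> is only defined almost everywhere; at the remaining points
  \<open>vector_derivative\<close> is an arbitrary value, which does not affect the Lebesgue integral
  (the completed measure \<open>lebesgue\<close> is used so that it does not affect measurability either).
  Jumps of \<open>x\<close> do not contribute.\<close>

definition has_caputo_derivative ::
    "real \<Rightarrow> (real \<Rightarrow> 'a::euclidean_space) \<Rightarrow> 'a \<Rightarrow> real \<Rightarrow> bool" where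
  "has_caputo_derivative \<alpha> x D t \<longleftrightarrow>
     set_integrable lebesgue {0..t} (\<lambda>s. (t - s) powr (- \<alpha>) *\<^sub>R vector_derivative x (at s)) \<and>
     D = (1 / Gamma (1 - \<alpha>)) *\<^sub>R
           (LINT s:{0..t}|lebesgue. (t - s) powr (- \<alpha>) *\<^sub>R vector_derivative x (at s))"

text \<open>Impulse times are \<open>\<tau> 0 = 0 < \<tau> 1 < \<dots> < \<tau> m < \<tau> (m + 1) = T\<close>. Only the values of \<open>x\<close> on
  \<open>{0..T}\<close> matter (up to the derivative at the two endpoints, a null set), so a solution on
  \<open>{0..T}\<close> is represented by any total function extending it.
  The library's \<open>closest_point K\<close> is the Euclidean projection onto \<open>K\<close>.\<close>

definition impulsive_solution ::
    "real \<Rightarrow> real \<Rightarrow> nat \<Rightarrow> (nat \<Rightarrow> real) \<Rightarrow> real^'n^'n \<Rightarrow> real^'n \<Rightarrow> real \<Rightarrow> (real^'n) set \<Rightarrow>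
     (nat \<Rightarrow> real^'n \<Rightarrow> real^'n) \<Rightarrow> real^'n \<Rightarrow> (real \<Rightarrow> real^'n) \<Rightarrow> bool" where
  "impulsive_solution \<alpha> T m \<tau> A b \<rho> K U x0 x \<longleftrightarrow>
     abs_cont_on {0..\<tau> 1} x \<and>
     (\<forall>k\<in>{1..m}. abs_cont_on {\<tau> k<..\<tau> (k + 1)} x) \<and>
     (AE t in lebesgue. t \<in> {0..T} - \<tau> ` {1..m} \<longrightarrow>
        has_caputo_derivative \<alpha> x
          (- x t + closest_point K (x t - \<rho> *\<^sub>R (A *v x t) - \<rho> *\<^sub>R b)) t) \<and>
     (\<forall>k\<in>{1..m}. \<exists>xminus xplus.
        (x \<longlongrightarrow> xminus) (at_left (\<tau> k)) \<and>
        (x \<longlongrightarrow> xplus) (at_right (\<tau> k)) \<and>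
        xminus = x (\<tau> k) \<and>
        xplus - xminus = U k (x (\<tau> k))) \<and>
     x 0 = x0"

end

theory Submission
  imports Defs
begin

text \<open>
  The bound is an a priori estimate for the Volterra integral equation behind the impulsive system.
  Write \<open>y\<close> for the almost everywhere derivative of a solution \<open>x\<close>, and \<open>f(x)\<close> for the right-hand
  side \<open>- x + P\<^sub>K (x - \<rho>Ax - \<rho>b)\<close>. The projection is 1-Lipschitz, so \<open>f\<close> grows at most linearly:
  \<open>norm (f x) \<le> C * (1 + norm x)\<close>.

  The differential equation says that the fractional integral of order \<open>1 - \<alpha>\<close> of \<open>y\<close> equals \<open>f(x)\<close>
  almost everywhere. Applying the fractional integral of order \<open>\<alpha>\<close> to both sides (Abel's inversion:
  Fubini and the Beta integral, lemma \<open>Abel_inversion\<close>) gives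
  \<open>\<integral>\<^sub>0\<^sup>t y = 1 / \<Gamma>(\<alpha>) * \<integral>\<^sub>0\<^sup>t (t - r)\<^bsup>\<alpha>-1\<^esup> f(x r) dr\<close>.
  On the other hand, \<open>x t - \<integral>\<^sub>0\<^sup>t y\<close> is constant between impulses and moves by at most \<open>l1\<close> at each
  impulse, hence stays within \<open>a = norm x0 + m * l1\<close> of the origin
  (lemma \<open>piecewise_ac_minus_integral_bound\<close>).

  A Gronwall argument finishes the proof. A solution is bounded, so
  \<open>\<Phi> = sup (norm (x t) * exp (- \<mu> t))\<close> is finite. Since \<open>norm (x r) \<le> \<Phi> * exp (\<mu> r)\<close>, and since
  convolving \<open>exp (\<mu> r)\<close> with the kernel \<open>t\<^bsup>\<alpha>-1\<^esup> / \<Gamma>(\<alpha>)\<close> costs at most a factor \<open>\<mu>\<^bsup>-\<alpha>\<^esup>\<close>, the two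
  facts combine to \<open>\<Phi> \<le> a + C * \<mu>\<^bsup>-\<alpha>\<^esup> * (1 + \<Phi>)\<close>. Choosing \<open>\<mu>\<close> with \<open>C * \<mu>\<^bsup>-\<alpha>\<^esup> = 1/2\<close> turns this into
  \<open>\<Phi> \<le> 2 * a + 1\<close>, a bound that depends only on the data.

  The step that needs real analysis is that \<open>y\<close> recovers the increments of \<open>x\<close>: an absolutely
  continuous function is differentiable almost everywhere, and its derivative integrates back to it.
  Differentiability comes from the Vitali covering theorem. If difference quotients below \<open>r\<close> and
  above \<open>s > r\<close> both occurred at all scales on a set of positive measure, one could cover almost all
  of that set by disjoint intervals of slope below \<open>r\<close>, and inside those again by intervals of slope
  above \<open>s\<close>. What is left over has small total length, so by absolute continuity it contributes
  almost nothing to the increment, and the two slopes contradict each other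
  (lemma \<open>ac_slope_gap_negligible\<close>). The integral formula is a gauge argument in which the tags at
  points of non-differentiability are confined to an open set of small measure.
\<close>

section \<open>Absolutely continuous functions and finite families of intervals\<close>

lemma division_real_interval:
  fixes D :: "real set set"
  assumes "D division_of S" "k \<in> D"
  shows "Inf k \<le> Sup k" "k = {Inf k..Sup k}" "measure lborel k = Sup k - Inf k"
    "interior k = {Inf k<..<Sup k}"
proof -
  from division_ofD(3,4)[OF assms] obtain u v where "k \<noteq> {}" "k = cbox u v" by blast
  then have k: "u \<le> v" "k = {u..v}" by auto
  show "Inf k \<le> Sup k" "k = {Inf k..Sup k}" "measure lborel k = Sup k - Inf k"
    "interior k = {Inf k<..<Sup k}" using k by auto
qed

text \<open>The definition of absolute continuity is about indexed families of nondegenerate intervals,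
  while gauge integration and the covering arguments produce divisions, which are sets of possibly
  degenerate intervals. This lemma translates one form into the other; degenerate members have
  zero increment and may be dropped.\<close>

lemma abs_cont_on_division:
  assumes ac: "abs_cont_on S f" and e: "\<epsilon> > 0"
  obtains \<delta> where "\<delta> > 0"
    "\<And>D. \<lbrakk>D division_of \<Union>D; \<Union>D \<subseteq> S; sum (measure lborel) D < \<delta>\<rbrakk>
       \<Longrightarrow> (\<Sum>k\<in>D. norm (f (Sup k) - f (Inf k))) < \<epsilon>"
proof -
  obtain \<delta> where d: "\<delta> > 0" and ac: "\<And>(N::nat) a b.
        (\<forall>i<N. a i < b i \<and> {a i..b i} \<subseteq> S) \<Longrightarrow>
        disjoint_family_on (\<lambda>i. {a i<..<b i}) {..<N} \<Longrightarrow>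
        (\<Sum>i<N. b i - a i) < \<delta> \<Longrightarrow> (\<Sum>i<N. norm (f (b i) - f (a i))) < \<epsilon>"
    using ac e unfolding abs_cont_on_def by meson
  show thesis
  proof (rule that[OF d])
    fix D assume D: "D division_of \<Union>D" and sub: "\<Union>D \<subseteq> S" and small: "sum (measure lborel) D < \<delta>"
    note k = division_real_interval[OF D]
    define E where "E = {k\<in>D. Inf k \<noteq> Sup k}"
    have fin: "finite D" using D by (rule division_of_finite)
    then obtain h where h: "bij_betw h {0..<card E} E"
      unfolding E_def using ex_bij_betw_nat_finite[of E] by (auto simp: E_def)
    then have h: "bij_betw h {..<card E} E" by (simp add: lessThan_atLeast0)
    have hE: "h i \<in> E" if "i < card E" for i using h that bij_betwE by blast
    have "(\<Sum>i<card E. norm (f (Sup (h i)) - f (Inf (h i)))) < \<epsilon>"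
    proof (rule ac)
      show "\<forall>i<card E. Inf (h i) < Sup (h i) \<and> {Inf (h i)..Sup (h i)} \<subseteq> S"
      proof (intro allI impI conjI)
        fix i assume "i < card E"
        then have i: "h i \<in> D" "Inf (h i) \<noteq> Sup (h i)" using hE by (auto simp: E_def)
        show "Inf (h i) < Sup (h i)" using k(1)[OF i(1)] i(2) by simp
        show "{Inf (h i)..Sup (h i)} \<subseteq> S" using k(2)[OF i(1)] i(1) sub by auto
      qed
      show "disjoint_family_on (\<lambda>i. {Inf (h i)<..<Sup (h i)}) {..<card E}"
        unfolding disjoint_family_on_def
      proof (intro ballI impI)
        fix i j assume ij: "i \<in> {..<card E}" "j \<in> {..<card E}" "i \<noteq> j"
        then have "h i \<noteq> h j" using h by (metis bij_betw_imp_inj_on inj_on_eq_iff)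
        moreover have "h i \<in> D" "h j \<in> D" using hE ij by (auto simp: E_def)
        ultimately show "{Inf (h i)<..<Sup (h i)} \<inter> {Inf (h j)<..<Sup (h j)} = {}"
          using division_ofD(5)[OF D] k(4) by metis
      qed
      have "(\<Sum>i<card E. Sup (h i) - Inf (h i)) = (\<Sum>k\<in>E. Sup k - Inf k)"
        by (rule sum.reindex_bij_betw[OF h])
      also have "\<dots> = (\<Sum>k\<in>D. Sup k - Inf k)"
        using fin by (intro sum.mono_neutral_left) (auto simp: E_def)
      also have "\<dots> = sum (measure lborel) D" using k(3) by (intro sum.cong) auto
      finally show "(\<Sum>i<card E. Sup (h i) - Inf (h i)) < \<delta>" using small by simp
    qed
    also have "(\<Sum>i<card E. norm (f (Sup (h i)) - f (Inf (h i)))) = (\<Sum>k\<in>E. norm (f (Sup k) - f (Inf k)))"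
      by (rule sum.reindex_bij_betw[OF h])
    also have "\<dots> = (\<Sum>k\<in>D. norm (f (Sup k) - f (Inf k)))"
      using fin by (intro sum.mono_neutral_left) (auto simp: E_def)
    finally show "(\<Sum>k\<in>D. norm (f (Sup k) - f (Inf k))) < \<epsilon>" .
  qed
qed

lemma abs_cont_on_subset: "abs_cont_on S f \<Longrightarrow> S' \<subseteq> S \<Longrightarrow> abs_cont_on S' f"
  unfolding abs_cont_on_def by (meson order_trans)

text \<open>Used for the components of a vector-valued function, which are controlled by its norm.\<close>

lemma abs_cont_on_norm_le:
  assumes "abs_cont_on S f" "\<And>x y. norm (g x - g y) \<le> norm (f x - f y)"
  shows "abs_cont_on S g"
  unfolding abs_cont_on_def
proof (intro allI impI)
  fix e::real assume "e > 0"
  with assms(1) obtain \<delta> where d: "\<delta> > 0" and ac: "\<And>(N::nat) a b.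
        (\<forall>i<N. a i < b i \<and> {a i..b i} \<subseteq> S) \<and>
        disjoint_family_on (\<lambda>i. {a i<..<b i}) {..<N} \<and>
        (\<Sum>i<N. b i - a i) < \<delta> \<Longrightarrow> (\<Sum>i<N. norm (f (b i) - f (a i))) < e"
    unfolding abs_cont_on_def by meson
  show "\<exists>\<delta>>0. \<forall>(N::nat) a b. (\<forall>i<N. a i < b i \<and> {a i..b i} \<subseteq> S) \<and>
        disjoint_family_on (\<lambda>i. {a i<..<b i}) {..<N} \<and>
        (\<Sum>i<N. b i - a i) < \<delta> \<longrightarrow> (\<Sum>i<N. norm (g (b i) - g (a i))) < e"
  proof (intro exI[of _ \<delta>] conjI d allI impI, elim conjE)
    fix N :: nat and a b :: "nat \<Rightarrow> real"
    assume "\<forall>i<N. a i < b i \<and> {a i..b i} \<subseteq> S"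
      "disjoint_family_on (\<lambda>i. {a i<..<b i}) {..<N}" "(\<Sum>i<N. b i - a i) < \<delta>"
    then have "(\<Sum>i<N. norm (f (b i) - f (a i))) < e" by (intro ac conjI)
    moreover have "(\<Sum>i<N. norm (g (b i) - g (a i))) \<le> (\<Sum>i<N. norm (f (b i) - f (a i)))"
      by (intro sum_mono assms(2))
    ultimately show "(\<Sum>i<N. norm (g (b i) - g (a i))) < e" by linarith
  qed
qed

lemma abs_cont_on_imp_continuous_on:
  assumes "abs_cont_on S f" "is_interval S"
  shows "continuous_on S f"
  unfolding continuous_on_iff
proof (intro ballI allI impI)
  fix x and e::real assume x: "x \<in> S" and "e > 0"
  from abs_cont_on_division[OF assms(1) \<open>e > 0\<close>] obtain \<delta> where d: "\<delta> > 0"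
    and ac: "\<And>D. \<lbrakk>D division_of \<Union>D; \<Union>D \<subseteq> S; sum (measure lborel) D < \<delta>\<rbrakk>
       \<Longrightarrow> (\<Sum>k\<in>D. norm (f (Sup k) - f (Inf k))) < e" by metis
  have *: "norm (f v - f u) < e" if "u \<in> S" "v \<in> S" "u \<le> v" "v - u < \<delta>" for u v
  proof -
    have "{u..v} \<subseteq> S" using mem_is_interval_1_I[OF assms(2) that(1,2)] by auto
    moreover have "{{u..v}} division_of \<Union>{{u..v}}" using division_of_self[of u v] that by simp
    ultimately show ?thesis using ac[of "{{u..v}}"] that by simp
  qed
  show "\<exists>d>0. \<forall>x'\<in>S. dist x' x < d \<longrightarrow> dist (f x') (f x) < e"
  proof (intro exI[of _ \<delta>] conjI d ballI impI)
    fix y assume "y \<in> S" "dist y x < \<delta>"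
    then show "dist (f y) (f x) < e"
      using *[of x y] *[of y x] x by (cases "x \<le> y") (auto simp: dist_norm norm_minus_commute)
  qed
qed

text \<open>The sum telescopes; tagging each interval with its left endpoint reduces it to the
  corresponding fact on tagged divisions.\<close>

lemma sum_increments_division:
  fixes f :: "real \<Rightarrow> 'a::real_normed_vector"
  assumes q: "q division_of {u..v}" and uv: "u \<le> v"
  shows "(\<Sum>k\<in>q. f (Sup k) - f (Inf k)) = f v - f u"
proof -
  have fin: "finite q" using q by (rule division_of_finite)
  note k = division_real_interval[OF q]
  let ?p = "(\<lambda>k. (Inf k, k)) ` q"
  have inj: "inj_on (\<lambda>k. (Inf k, k)) q" by (auto simp: inj_on_def)
  have "?p tagged_division_of {u..v}"
  proof (rule tagged_division_ofI)
    show "finite ?p" using fin by auto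
    fix x K assume "(x, K) \<in> ?p"
    then have K: "K \<in> q" "x = Inf K" by auto
    show "x \<in> K" using k(1,2)[OF K(1)] K(2) by (metis atLeastAtMost_iff order_refl)
    show "K \<subseteq> {u..v}" using division_ofD(2)[OF q K(1)] .
    show "\<exists>a b. K = cbox a b" using k(2)[OF K(1)] by (metis box_real(2))
  next
    fix x1 K1 x2 K2 assume "(x1,K1) \<in> ?p" "(x2,K2) \<in> ?p" "(x1,K1) \<noteq> (x2,K2)"
    then show "interior K1 \<inter> interior K2 = {}" using division_ofD(5)[OF q] by auto
  next
    show "\<Union>{K. \<exists>x. (x, K) \<in> ?p} = {u..v}"
      using division_ofD(6)[OF q] by (simp add: image_iff)
  qed
  from additive_tagged_division_1[OF uv this, of f]
  show ?thesis by (simp add: sum.reindex[OF inj])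
qed

text \<open>A finite, measured form of the Vitali covering theorem on the line. The countable disjoint
  family of the covering theorem covers \<open>E\<close> up to a null set, and its total length is at most the
  finite measure of \<open>W\<close>; a finite subfamily therefore already leaves less than \<open>\<epsilon>\<close> uncovered.\<close>

lemma Vitali_intervals:
  fixes P :: "real \<Rightarrow> real \<Rightarrow> bool"
  assumes E: "E \<in> sets lebesgue" "E \<subseteq> W" and W: "open W" "W \<in> lmeasurable"
    and fine: "\<And>x d. x \<in> E \<Longrightarrow> d > 0 \<Longrightarrow> \<exists>u v. u < v \<and> v - u < d \<and> x \<in> {u..v} \<and> P u v"
    and e: "\<epsilon> > 0"
  obtains D where "D division_of \<Union>D" "disjoint D" "\<Union>D \<subseteq> W"
    "\<And>k. k \<in> D \<Longrightarrow> Inf k < Sup k \<and> P (Inf k) (Sup k)" "measure lebesgue (E - \<Union>D) < \<epsilon>"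
proof -
  define I where "I = {(u,v). u < v \<and> P u v \<and> {u..v} \<subseteq> W}"
  define c where "c = (\<lambda>(u::real,v). (u+v)/2)"
  define r where "r = (\<lambda>(u::real,v). (v-u)/2)"
  have cb: "cball (c i) (r i) = {fst i..snd i}" for i
    by (cases i) (auto simp: c_def r_def cball_eq_atLeastAtMost field_simps)
  obtain C where C: "countable C" "C \<subseteq> I"
     and dj: "pairwise (\<lambda>i j. disjnt (cball (c i) (r i)) (cball (c j) (r j))) C"
     and neg: "negligible(E - (\<Union>i \<in> C. cball (c i) (r i)))"
  proof (rule Vitali_covering_theorem_cballs[of I r E c])
    show "0 < r i" if "i \<in> I" for i using that by (auto simp: I_def r_def)
    fix x d::real assume x: "x \<in> E" and d: "0 < d"
    obtain d' where d': "d' > 0" "ball x d' \<subseteq> W" using x E W(1) open_contains_ball by blast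
    obtain u v where uv: "u < v" "v - u < min d d'" "x \<in> {u..v}" "P u v"
      using fine[OF x, of "min d d'"] d d' by auto
    have "{u..v} \<subseteq> ball x d'" using uv by (auto simp: dist_real_def)
    then have "(u,v) \<in> I" using uv d' by (auto simp: I_def)
    then show "\<exists>i. i \<in> I \<and> x \<in> cball (c i) (r i) \<and> r i < d"
      using uv cb[of "(u,v)"] by (intro exI[of _ "(u,v)"]) (auto simp: r_def)
  qed auto
  define F where "F = (\<lambda>i::real\<times>real. {fst i..snd i}) ` C"
  have FI: "\<exists>u v. u < v \<and> P u v \<and> {u..v} \<subseteq> W \<and> k = {u..v}" if "k \<in> F" for k
    using that C(2) by (force simp: F_def I_def)
  have cF: "countable F" using C by (auto simp: F_def)
  have disjF: "disjoint F" unfolding disjoint_def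
  proof (intro ballI impI)
    fix k l assume "k \<in> F" "l \<in> F" "k \<noteq> l"
    then obtain i j where "i \<in> C" "j \<in> C" "k = {fst i..snd i}" "l = {fst j..snd j}" by (auto simp: F_def)
    moreover from this \<open>k \<noteq> l\<close> have "i \<noteq> j" by auto
    ultimately show "k \<inter> l = {}" using dj unfolding cb pairwise_def disjnt_def by blast
  qed
  have UF: "\<Union>F \<subseteq> W" using FI by blast
  have Fm: "k \<in> lmeasurable" if "k \<in> F" for k using FI[OF that] by auto
  have UFm: "\<Union>F \<in> lmeasurable"
    using cF UF W(2) Fm by (meson fmeasurableD fmeasurableI2 sets.countable_Union subsetI)
  obtain D where D: "D \<subseteq> F" "finite D" "measure lebesgue (\<Union>F) - \<epsilon> < measure lebesgue (\<Union>D)"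
  proof (rule measure_countable_Union_approachable[OF cF e, of "measure lebesgue (\<Union>F)"])
    show "measure lebesgue (\<Union>D') \<le> measure lebesgue (\<Union>F)" if "D' \<subseteq> F" "finite D'" for D'
      using that Fm UFm by (intro measure_mono_fmeasurable) (auto intro!: fmeasurableD)
  qed (use Fm in auto)
  have Dm: "\<Union>D \<in> lmeasurable" using D Fm by (intro fmeasurable.finite_Union) auto
  show thesis
  proof (rule that)
    show "disjoint D" using disjF D(1) by (rule pairwise_subset)
    show "D division_of \<Union>D"
    proof (rule division_ofI)
      show "finite D" by fact
      show "K \<subseteq> \<Union>D" if "K \<in> D" for K using that by auto
      show "K \<noteq> {}" if "K \<in> D" for K using FI[of K] that D(1) by force
      show "\<exists>a b. K = cbox a b" if "K \<in> D" for K using FI[of K] that D(1) by force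
      show "interior K1 \<inter> interior K2 = {}" if "K1 \<in> D" "K2 \<in> D" "K1 \<noteq> K2" for K1 K2
      proof -
        have "K1 \<inter> K2 = {}" using disjF that D(1) unfolding disjoint_def by blast
        then show ?thesis by (metis Int_mono interior_subset subset_empty)
      qed
    qed simp
    show "\<Union>D \<subseteq> W" using D(1) UF by blast
    show "Inf k < Sup k \<and> P (Inf k) (Sup k)" if "k \<in> D" for k
    proof -
      obtain u v where "u < v" "P u v" "k = {u..v}" using FI[of k] \<open>k \<in> D\<close> D(1) by auto
      then show ?thesis by simp
    qed
    have "E - \<Union>F \<in> null_sets lebesgue" using neg by (simp add: negligible_iff_null_sets F_def cb)
    have "measure lebesgue (E - \<Union>D) \<le> measure lebesgue ((\<Union>F - \<Union>D) \<union> (E - \<Union>F))"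
      using E(1) UFm Dm neg by (intro measure_mono_fmeasurable) (auto simp: F_def cb intro: fmeasurableD negligible_imp_measurable)
    also have "\<dots> = measure lebesgue (\<Union>F - \<Union>D)"
      using UFm Dm \<open>E - \<Union>F \<in> null_sets lebesgue\<close> by (intro measure_Un_null_set) auto
    also have "\<dots> = measure lebesgue (\<Union>F) - measure lebesgue (\<Union>D)"
      using UFm Dm D(1) by (intro measurable_measure_Diff) auto
    also have "\<dots> < \<epsilon>" using D(3) by simp
    finally show "measure lebesgue (E - \<Union>D) < \<epsilon>" .
  qed
qed

section \<open>Almost everywhere differentiability\<close>

text \<open>If the intervals of \<open>D2\<close> sit inside the disjoint intervals of \<open>D1\<close>, then the part of \<open>D1\<close> not
  in \<open>D2\<close> can itself be cut into intervals: each member of \<open>D1\<close> has a division extending the members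
  of \<open>D2\<close> in it, and \<open>R\<close> collects the added pieces. The identity is used with \<open>h\<close> the given
  function and with \<open>h\<close> the identity, which makes it an identity of lengths.\<close>

lemma complement_division:
  fixes D1 D2 :: "real set set"
  assumes D1: "D1 division_of \<Union>D1" "disjoint D1" and D2: "D2 division_of \<Union>D2"
    and sub: "\<And>j. j \<in> D2 \<Longrightarrow> \<exists>k\<in>D1. j \<subseteq> k"
  obtains R where "R division_of \<Union>R" "\<Union>R \<subseteq> \<Union>D1"
    "\<And>h :: real \<Rightarrow> real. (\<Sum>k\<in>D1. h (Sup k) - h (Inf k)) =
       (\<Sum>k\<in>R. h (Sup k) - h (Inf k)) + (\<Sum>k\<in>D2. h (Sup k) - h (Inf k))"
proof -
  note k1 = division_real_interval[OF D1(1)]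
  have "\<exists>q. {j\<in>D2. j \<subseteq> k} \<subseteq> q \<and> q division_of {Inf k..Sup k}" if "k \<in> D1" for k
  proof -
    have "{j\<in>D2. j \<subseteq> k} division_of \<Union>{j\<in>D2. j \<subseteq> k}" by (rule division_of_subset[OF D2]) auto
    moreover have "\<Union>{j\<in>D2. j \<subseteq> k} \<subseteq> cbox (Inf k) (Sup k)" using k1(2)[OF that] by auto
    ultimately obtain q where "{j\<in>D2. j \<subseteq> k} \<subseteq> q" "q division_of cbox (Inf k) (Sup k)"
      by (rule partial_division_extend_interval)
    then show ?thesis by auto
  qed
  then obtain q where q: "\<And>k. k \<in> D1 \<Longrightarrow> {j\<in>D2. j \<subseteq> k} \<subseteq> q k"
    "\<And>k. k \<in> D1 \<Longrightarrow> q k division_of {Inf k..Sup k}" by metis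
  define Q where "Q = (\<Union>k\<in>D1. q k)"
  have fin1: "finite D1" by (rule division_of_finite[OF D1(1)])
  have finq: "finite (q k)" if "k \<in> D1" for k by (rule division_of_finite[OF q(2)[OF that]])
  have qk: "j \<subseteq> k" "j \<noteq> {}" if "k \<in> D1" "j \<in> q k" for j k
    using division_ofD(2,3)[OF q(2)[OF that(1)] that(2)] k1(2)[OF that(1)] by auto
  have D2Q: "D2 \<subseteq> Q"
  proof
    fix j assume "j \<in> D2"
    with sub obtain k where "k \<in> D1" "j \<subseteq> k" by blast
    then show "j \<in> Q" using q(1)[of k] \<open>j \<in> D2\<close> by (auto simp: Q_def)
  qed
  have disj: "k \<inter> l = {}" if "k \<in> D1" "l \<in> D1" "k \<noteq> l" for k l
    using D1(2) that unfolding disjoint_def by blast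
  have qdisj: "q k \<inter> q l = {}" if "k \<in> D1" "l \<in> D1" "k \<noteq> l" for k l
    using qk[OF that(1)] qk[OF that(2)] disj[OF that] by blast
  have Q: "Q division_of \<Union>Q"
  proof (rule division_ofI)
    show "finite Q" using fin1 finq by (auto simp: Q_def)
    show "K \<subseteq> \<Union>Q" if "K \<in> Q" for K using that by auto
    show "K \<noteq> {}" if "K \<in> Q" for K using that qk by (auto simp: Q_def)
    show "\<exists>a b. K = cbox a b" if "K \<in> Q" for K
      using that division_ofD(4)[OF q(2)] by (auto simp: Q_def)
    show "interior K1 \<inter> interior K2 = {}" if K: "K1 \<in> Q" "K2 \<in> Q" "K1 \<noteq> K2" for K1 K2
    proof -
      obtain k l where kl: "k \<in> D1" "K1 \<in> q k" "l \<in> D1" "K2 \<in> q l" using K by (auto simp: Q_def)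
      show ?thesis
      proof (cases "k = l")
        case True then show ?thesis using division_ofD(5)[OF q(2)[OF kl(1)]] kl K by auto
      next
        case False
        then have "K1 \<inter> K2 = {}" using disj[OF kl(1,3)] qk(1)[OF kl(1,2)] qk(1)[OF kl(3,4)] by blast
        then show ?thesis by (metis Int_mono interior_subset subset_empty)
      qed
    qed
  qed simp
  show thesis
  proof (rule that)
    show "(Q - D2) division_of \<Union>(Q - D2)" by (rule division_of_subset[OF Q]) auto
    show "\<Union>(Q - D2) \<subseteq> \<Union>D1" using qk(1) by (fastforce simp: Q_def)
    fix h :: "real \<Rightarrow> real"
    have "(\<Sum>k\<in>D1. h (Sup k) - h (Inf k)) = (\<Sum>k\<in>D1. \<Sum>j\<in>q k. h (Sup j) - h (Inf j))"
      by (intro sum.cong refl sum_increments_division[symmetric] q(2) k1(1))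
    also have "\<dots> = (\<Sum>j\<in>Q. h (Sup j) - h (Inf j))"
      unfolding Q_def using fin1 finq qdisj by (intro sum.UNION_disjoint[symmetric]) auto
    also have "\<dots> = (\<Sum>k\<in>Q - D2. h (Sup k) - h (Inf k)) + (\<Sum>k\<in>D2. h (Sup k) - h (Inf k))"
      by (intro sum.subset_diff D2Q division_of_finite[OF Q])
    finally show "(\<Sum>k\<in>D1. h (Sup k) - h (Inf k)) =
      (\<Sum>k\<in>Q - D2. h (Sup k) - h (Inf k)) + (\<Sum>k\<in>D2. h (Sup k) - h (Inf k))" .
  qed
qed

lemma measure_division:
  fixes D :: "real set set"
  assumes "D division_of \<Union>D"
  shows "measure lebesgue (\<Union>D) = (\<Sum>k\<in>D. Sup k - Inf k)" "\<Union>D \<in> lmeasurable"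
proof -
  have "measure lebesgue (\<Union>D) = (\<Sum>k\<in>D. measure lebesgue k)" by (rule content_division[symmetric, OF assms])
  also have "\<dots> = (\<Sum>k\<in>D. Sup k - Inf k)"
  proof (rule sum.cong)
    fix k assume "k \<in> D"
    then obtain u v where "k \<noteq> {}" "k = cbox u v" using division_ofD(3,4)[OF assms] by metis
    then show "measure lebesgue k = Sup k - Inf k" by simp
  qed simp
  finally show "measure lebesgue (\<Union>D) = (\<Sum>k\<in>D. Sup k - Inf k)" .
  show "\<Union>D \<in> lmeasurable" by (rule lmeasurable_division[OF assms])
qed

text \<open>Requiring \<open>x\<close> to lie strictly inside \<open>[u, v]\<close>, rather than at an end as in a Dini derivative,
  makes this set a countable intersection of open sets whatever \<open>P\<close> is, so that measurability comes
  for free. Nothing is lost for continuous functions: see \<open>slope_bound_at_continuity_point\<close>.\<close>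

definition frequent_points :: "real \<Rightarrow> real \<Rightarrow> (real \<Rightarrow> real \<Rightarrow> bool) \<Rightarrow> real set" where
  "frequent_points a b P =
     {x. \<forall>d>0. \<exists>u v. a \<le> u \<and> u < x \<and> x < v \<and> v \<le> b \<and> v - u < d \<and> P u v}"

lemma frequent_points_subset: "frequent_points a b P \<subseteq> {a<..<b}"
proof
  fix x assume "x \<in> frequent_points a b P"
  then obtain u v where "a \<le> u" "u < x" "x < v" "v \<le> b"
    unfolding frequent_points_def using zero_less_one by blast
  then show "x \<in> {a<..<b}" by auto
qed

lemma frequent_points_lmeasurable: "frequent_points a b P \<in> lmeasurable"
proof -
  define V where "V = (\<lambda>n::nat. \<Union>{{u<..<v} |u v. a \<le> u \<and> v \<le> b \<and> v - u < 1 / Suc n \<and> P u v})"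
  have "frequent_points a b P = (\<Inter>n. V n)"
  proof (intro equalityI subsetI INT_I)
    fix x n assume "x \<in> frequent_points a b P"
    moreover have "1 / real (Suc n) > 0" by simp
    ultimately obtain u v where "a \<le> u" "u < x" "x < v" "v \<le> b" "v - u < 1 / Suc n" "P u v"
      unfolding frequent_points_def by blast
    then show "x \<in> V n" unfolding V_def by (intro UnionI[of "{u<..<v}"]) auto
  next
    fix x assume x: "x \<in> (\<Inter>n. V n)"
    show "x \<in> frequent_points a b P" unfolding frequent_points_def
    proof (intro CollectI allI impI)
      fix d :: real assume "d > 0"
      then obtain n where n: "1 / Suc n < d" using nat_approx_posE by blast
      have "x \<in> V n" using x by auto
      then obtain u v where "a \<le> u" "u < x" "x < v" "v \<le> b" "v - u < 1 / Suc n" "P u v"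
        unfolding V_def by auto
      then show "\<exists>u v. a \<le> u \<and> u < x \<and> x < v \<and> v \<le> b \<and> v - u < d \<and> P u v"
        using n by (intro exI[of _ u] exI[of _ v]) auto
    qed
  qed
  moreover have "V n \<in> sets borel" for n unfolding V_def by (intro borel_open open_Union) auto
  ultimately have "frequent_points a b P \<in> sets borel" by auto
  then show ?thesis
    by (intro bounded_set_imp_lmeasurable bounded_subset[OF _ frequent_points_subset[of a b P]]) auto
qed

text \<open>Let \<open>E\<close> be the intersection, and enclose it in an open set \<open>W\<close> of barely larger measure.
  Vitali's theorem gives disjoint intervals \<open>D1\<close> of slope below \<open>r\<close> in \<open>W\<close> that cover most of \<open>E\<close>,
  and then disjoint intervals \<open>D2\<close> of slope above \<open>s\<close> inside those of \<open>D1\<close> that still cover most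
  of \<open>E\<close>. The remainder \<open>R\<close> of \<open>D1\<close> is shorter than the tolerance of absolute continuity. Comparing
  increments, \<open>s * |D2| - \<epsilon> \<le> r * |D1|\<close> with \<open>|D1|\<close> and \<open>|D2|\<close> both close to the measure of \<open>E\<close>,
  which forces that measure to vanish.\<close>

lemma ac_slope_gap_negligible:
  fixes f :: "real \<Rightarrow> real"
  assumes ac: "abs_cont_on {a..b} f" and rs: "r < s"
  shows "negligible (frequent_points a b (\<lambda>u v. f v - f u < r * (v - u)) \<inter>
                     frequent_points a b (\<lambda>u v. f v - f u > s * (v - u)))"
proof -
  let ?Lo = "frequent_points a b (\<lambda>u v. f v - f u < r * (v - u))"
  let ?Hi = "frequent_points a b (\<lambda>u v. f v - f u > s * (v - u))"
  define E where "E = ?Lo \<inter> ?Hi"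
  have Em: "E \<in> lmeasurable" unfolding E_def by (intro fmeasurable.Int frequent_points_lmeasurable)
  have Esub: "E \<subseteq> {a<..<b}" unfolding E_def using frequent_points_subset[of a b] by blast
  let ?m = "measure lebesgue"
  have key: "(s - r) * (?m E - \<epsilon>) \<le> \<epsilon> * (1 + \<bar>r\<bar>)" if e: "\<epsilon> > 0" for \<epsilon>
  proof -
    from abs_cont_on_division[OF ac e] obtain \<delta>0 where d0: "\<delta>0 > 0"
      and ac': "\<And>D. \<lbrakk>D division_of \<Union>D; \<Union>D \<subseteq> {a..b}; sum (measure lborel) D < \<delta>0\<rbrakk>
         \<Longrightarrow> (\<Sum>k\<in>D. norm (f (Sup k) - f (Inf k))) < \<epsilon>" by metis
    define \<delta> where "\<delta> = min \<delta>0 \<epsilon>"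
    have d: "\<delta> > 0" "\<delta> \<le> \<delta>0" "\<delta> \<le> \<epsilon>" using d0 e by (auto simp: \<delta>_def)
    have d3: "\<delta>/3 > 0" using d by simp
    obtain T0 where T0: "open T0" "E \<subseteq> T0" "T0 - E \<in> lmeasurable" "emeasure lebesgue (T0 - E) < ennreal (\<delta>/3)"
      using sets_lebesgue_outer_open[OF fmeasurableD[OF Em] d3] by blast
    define W where "W = T0 \<inter> {a<..<b}"
    have W: "open W" "W \<in> lmeasurable" "E \<subseteq> W" "W \<subseteq> {a<..<b}"
      using T0 Esub unfolding W_def by (auto intro!: bounded_set_imp_lmeasurable bounded_Int)
    have mW: "?m W < ?m E + \<delta>/3"
    proof -
      have "?m W \<le> ?m (E \<union> (T0 - E))" using T0 Em W
        by (intro measure_mono_fmeasurable fmeasurable.Un) (auto simp: W_def intro: fmeasurableD)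
      also have "\<dots> \<le> ?m E + ?m (T0 - E)"
        using T0 Em by (intro measure_Un_le) auto
      also have "?m (T0 - E) < \<delta>/3"
        using T0(3,4) d3 by (simp add: emeasure_eq_measure2 ennreal_less_iff)
      finally show ?thesis by simp
    qed
    have fine1: "\<exists>u v. u < v \<and> v - u < d \<and> x \<in> {u..v} \<and> f v - f u < r * (v - u)"
      if x: "x \<in> E" "0 < d" for x d
    proof -
      obtain u v where "u < x" "x < v" "v - u < d" "f v - f u < r * (v - u)"
        using x unfolding E_def frequent_points_def by blast
      then show ?thesis by (intro exI[of _ u] exI[of _ v]) auto
    qed
    obtain D1 where D1: "D1 division_of \<Union>D1" "disjoint D1" "\<Union>D1 \<subseteq> W"
      "\<And>k. k \<in> D1 \<Longrightarrow> Inf k < Sup k \<and> f (Sup k) - f (Inf k) < r * (Sup k - Inf k)"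
      "?m (E - \<Union>D1) < \<delta>/3"
      using Vitali_intervals[OF fmeasurableD[OF Em] W(3,1,2) fine1 d3] by metis
    note k1 = division_real_interval[OF D1(1)]
    \<comment> \<open>The second cover has to live in an open set; passing to interiors discards only the
      finitely many endpoints of the intervals of \<open>D1\<close>.\<close>
    define W2 where "W2 = (\<Union>k\<in>D1. interior k)"
    have fin1: "finite D1" by (rule division_of_finite[OF D1(1)])
    have W2: "open W2" "W2 \<subseteq> \<Union>D1" unfolding W2_def using interior_subset by (auto intro!: open_interior)
    have W2m: "W2 \<in> lmeasurable"
      using W2 D1(3) W(4) by (intro bounded_set_imp_lmeasurable bounded_subset[of "{a<..<b}" W2]) auto
    have E2m: "E \<inter> W2 \<in> lmeasurable" using Em W2m by (rule fmeasurable.Int)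
    have mE2: "?m E - \<delta>/3 < ?m (E \<inter> W2)"
    proof -
      have fr: "negligible (\<Union>D1 - W2)"
      proof (rule negligible_finite, rule finite_subset)
        show "\<Union>D1 - W2 \<subseteq> Inf ` D1 \<union> Sup ` D1"
        proof
          fix x assume x: "x \<in> \<Union>D1 - W2"
          then obtain k where k: "k \<in> D1" "x \<in> k" by blast
          then have "x \<in> {Inf k..Sup k}" "x \<notin> {Inf k<..<Sup k}" using k1(2,4)[OF k(1)] x by (auto simp: W2_def)
          then have "x = Inf k \<or> x = Sup k" by auto
          then show "x \<in> Inf ` D1 \<union> Sup ` D1" using k by auto
        qed
      qed (use fin1 in auto)
      have EDm: "E - \<Union>D1 \<in> lmeasurable" using Em measure_division(2)[OF D1(1)] by (intro fmeasurable_Diff fmeasurableD)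
      have "?m E \<le> ?m ((E \<inter> W2 \<union> (E - \<Union>D1)) \<union> (\<Union>D1 - W2))"
        using Em E2m EDm fr by (intro measure_mono_fmeasurable fmeasurable.Un) (auto intro: fmeasurableD negligible_imp_measurable)
      also have "\<dots> = ?m (E \<inter> W2 \<union> (E - \<Union>D1))"
        using fr E2m EDm by (intro measure_Un_null_set) (auto simp: negligible_iff_null_sets intro!: fmeasurableD)
      also have "\<dots> \<le> ?m (E \<inter> W2) + ?m (E - \<Union>D1)" using E2m EDm by (intro measure_Un_le) auto
      finally show ?thesis using D1(5) by simp
    qed
    have fine2: "\<exists>u v. u < v \<and> v - u < d \<and> x \<in> {u..v} \<and>
        (f v - f u > s * (v - u) \<and> (\<exists>j\<in>D1. {u..v} \<subseteq> j))" if x: "x \<in> E \<inter> W2" "0 < d" for x d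
    proof -
      obtain j where j: "j \<in> D1" "x \<in> interior j" using x by (auto simp: W2_def)
      then obtain d' where d': "d' > 0" "ball x d' \<subseteq> j" by (meson mem_interior)
      have m: "min d d' > 0" using x d' by simp
      obtain u v where uv: "u < x" "x < v" "v - u < min d d'" "f v - f u > s * (v - u)"
        using x m unfolding E_def frequent_points_def by blast
      have "{u..v} \<subseteq> ball x d'" using uv by (auto simp: dist_real_def)
      then have "{u..v} \<subseteq> j" using d'(2) by simp
      then show ?thesis using uv j(1) by (intro exI[of _ u] exI[of _ v]) auto
    qed
    obtain D2 where D2: "D2 division_of \<Union>D2" "disjoint D2" "\<Union>D2 \<subseteq> W2"
      "\<And>k. k \<in> D2 \<Longrightarrow> Inf k < Sup k \<and> (f (Sup k) - f (Inf k) > s * (Sup k - Inf k) \<and>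
             (\<exists>j\<in>D1. {Inf k..Sup k} \<subseteq> j))"
      "?m (E \<inter> W2 - \<Union>D2) < \<delta>/3"
      using Vitali_intervals[OF fmeasurableD[OF E2m] Int_lower2 W2(1) W2m fine2 d3] by metis
    have "\<exists>k\<in>D1. j \<subseteq> k" if jD2: "j \<in> D2" for j
    proof -
      obtain k where k: "k \<in> D1" "{Inf j..Sup j} \<subseteq> k" using D2(4)[OF jD2] by blast
      then show ?thesis using ord_eq_le_trans[OF division_real_interval(2)[OF D2(1) jD2] k(2)] by blast
    qed
    from complement_division[OF D1(1,2) D2(1) this] obtain R where R: "R division_of \<Union>R" "\<Union>R \<subseteq> \<Union>D1"
      "\<And>h :: real \<Rightarrow> real. (\<Sum>k\<in>D1. h (Sup k) - h (Inf k)) =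
       (\<Sum>k\<in>R. h (Sup k) - h (Inf k)) + (\<Sum>k\<in>D2. h (Sup k) - h (Inf k))" by blast
    define L1 L2 LR where L: "L1 = (\<Sum>k\<in>D1. Sup k - Inf k)" "L2 = (\<Sum>k\<in>D2. Sup k - Inf k)"
      "LR = (\<Sum>k\<in>R. Sup k - Inf k)"
    have LL: "L1 = LR + L2" using R(3)[of "\<lambda>x. x"] by (simp add: L)
    have "L1 \<le> ?m W" unfolding L measure_division(1)[OF D1(1), symmetric]
      using D1(3) W(2) measure_division(2)[OF D1(1)] by (intro measure_mono_fmeasurable) auto
    have L2: "?m (E \<inter> W2) < L2 + \<delta>/3"
    proof -
      have "?m (E \<inter> W2) \<le> ?m (\<Union>D2 \<union> (E \<inter> W2 - \<Union>D2))"
        using E2m measure_division(2)[OF D2(1)] by (intro measure_mono_fmeasurable fmeasurable.Un fmeasurable_Diff) (auto intro: fmeasurableD)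
      also have "\<dots> \<le> ?m (\<Union>D2) + ?m (E \<inter> W2 - \<Union>D2)"
        using E2m measure_division(2)[OF D2(1)] by (intro measure_Un_le) (auto intro!: fmeasurableD fmeasurable_Diff)
      finally show ?thesis using D2(5) measure_division(1)[OF D2(1)] L by simp
    qed
    \<comment> \<open>Three errors of \<open>\<delta> / 3\<close>: the excess of \<open>W\<close> over \<open>E\<close>, and what each of the two covers misses.\<close>
    have LR: "LR < \<delta>" using LL L2 \<open>L1 \<le> ?m W\<close> mW mE2 by linarith
    have LR0: "0 \<le> LR" unfolding L using division_real_interval(1)[OF R(1)] by (intro sum_nonneg) auto
    have "(\<Sum>k\<in>R. norm (f (Sup k) - f (Inf k))) < \<epsilon>"
    proof (rule ac'[OF R(1)])
      show "\<Union>R \<subseteq> {a..b}" 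
        by (rule order_trans[OF R(2) order_trans[OF D1(3) order_trans[OF W(4)]]]) auto
      have "sum (measure lborel) R = LR" unfolding L
        using division_real_interval(3)[OF R(1)] by (intro sum.cong) auto
      then show "sum (measure lborel) R < \<delta>0" using LR d by simp
    qed
    then have 1: "\<bar>\<Sum>k\<in>R. f (Sup k) - f (Inf k)\<bar> < \<epsilon>"
      using order_le_less_trans[OF norm_sum] by fastforce
    have 2: "(\<Sum>k\<in>D1. f (Sup k) - f (Inf k)) \<le> r * L1"
      unfolding L sum_distrib_left using D1(4) by (intro sum_mono) (auto intro: less_imp_le)
    have 3: "(\<Sum>k\<in>D2. f (Sup k) - f (Inf k)) \<ge> s * L2"
      unfolding L sum_distrib_left using D2(4) by (intro sum_mono) (auto intro: less_imp_le)
    have "(s - r) * L2 \<le> \<epsilon> + r * LR"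
      using 1 2 3 R(3)[of f] LL by (simp add: algebra_simps)
    also have "r * LR \<le> \<bar>r\<bar> * \<epsilon>" using LR LR0 d by (intro mult_mono) auto
    finally have "(s - r) * L2 \<le> \<epsilon> * (1 + \<bar>r\<bar>)" by (simp add: algebra_simps)
    moreover have "?m E - \<epsilon> \<le> L2" using L2 mE2 d by linarith
    then have "(s - r) * (?m E - \<epsilon>) \<le> (s - r) * L2" using rs by (intro mult_left_mono) auto
    ultimately show ?thesis by linarith
  qed
  have "?m E \<le> 0 + \<eta>" if "\<eta> > 0" for \<eta>
  proof -
    define C where "C = (s - r) + (1 + \<bar>r\<bar>)"
    have C: "C > 0" using rs by (simp add: C_def)
    have "(s - r) * ?m E \<le> \<epsilon> * C" if "\<epsilon> > 0" for \<epsilon>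
      using key[OF that] by (simp add: C_def algebra_simps)
    from this[of "\<eta> * (s - r) / C"] have "(s - r) * ?m E \<le> (s - r) * \<eta>"
      using C rs that by (simp add: mult.commute)
    then show ?thesis using rs by simp
  qed
  then have "?m E \<le> 0" by (rule field_le_epsilon)
  then have "?m E = 0" using measure_nonneg[of lebesgue E] by linarith
  then show ?thesis using Em unfolding E_def[symmetric] by (simp add: negligible_iff_measure)
qed

lemma not_frequent_pointsE:
  assumes "x \<notin> frequent_points a b P"
  obtains d where "d > 0" "\<And>u v. \<lbrakk>a \<le> u; u < x; x < v; v \<le> b; v - u < d\<rbrakk> \<Longrightarrow> \<not> P u v"
  using assms unfolding frequent_points_def by blast

text \<open>On a set shorter than the tolerance \<open>\<delta>\<close> for total variation 1, intervals of slope at least \<open>n\<close>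
  in absolute value have total length at most \<open>1 / n\<close>. So the set of points with unbounded slopes is
  null in every ball of radius \<open>\<delta> / 3\<close>, hence null.\<close>

lemma ac_unbounded_slope_negligible:
  fixes f :: "real \<Rightarrow> real"
  assumes ac: "abs_cont_on {a..b} f"
  shows "negligible (\<Inter>n::nat. frequent_points a b (\<lambda>u v. \<bar>f v - f u\<bar> > real n * (v - u)))"
proof -
  define E where "E = (\<Inter>n::nat. frequent_points a b (\<lambda>u v. \<bar>f v - f u\<bar> > real n * (v - u)))"
  have Esub: "E \<subseteq> {a<..<b}" unfolding E_def using frequent_points_subset[of a b] by blast
  have "E \<in> sets lebesgue" unfolding E_def
    using frequent_points_lmeasurable[THEN fmeasurableD] by (intro sets.countable_INT) auto
  then have Em: "E \<in> lmeasurable"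
    by (intro bounded_set_imp_lmeasurable bounded_subset[OF _ Esub]) auto
  let ?m = "measure lebesgue"
  from abs_cont_on_division[OF ac zero_less_one] obtain \<delta> where d: "\<delta> > 0"
    and ac': "\<And>D. \<lbrakk>D division_of \<Union>D; \<Union>D \<subseteq> {a..b}; sum (measure lborel) D < \<delta>\<rbrakk>
       \<Longrightarrow> (\<Sum>k\<in>D. norm (f (Sup k) - f (Inf k))) < 1" by metis
  have local: "negligible (E \<inter> ball c (\<delta>/3))" for c
  proof (rule ccontr)
    define F where "F = E \<inter> ball c (\<delta>/3)"
    define W where "W = ball c (\<delta>/3) \<inter> {a<..<b}"
    assume "\<not> negligible (E \<inter> ball c (\<delta>/3))"
    moreover have Fm: "F \<in> lmeasurable" unfolding F_def using Em by (intro fmeasurable.Int) auto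
    ultimately have pos: "?m F > 0"
      unfolding F_def[symmetric] using negligible_iff_measure0 zero_less_measure_iff by blast
    obtain n :: nat where n: "real n > 2 / ?m F" using reals_Archimedean2 by blast
    have W: "open W" "W \<in> lmeasurable" "F \<subseteq> W" "W \<subseteq> {a<..<b}" "W \<subseteq> ball c (\<delta>/3)"
      using Esub unfolding W_def F_def by (auto intro!: bounded_set_imp_lmeasurable bounded_Int)
    have fine: "\<exists>u v. u < v \<and> v - u < d \<and> x \<in> {u..v} \<and> \<bar>f v - f u\<bar> > real n * (v - u)"
      if x: "x \<in> F" "0 < d" for x d
    proof -
      have "x \<in> frequent_points a b (\<lambda>u v. \<bar>f v - f u\<bar> > real n * (v - u))"
        using x(1) unfolding F_def E_def by blast
      then obtain u v where "u < x" "x < v" "v - u < d" "\<bar>f v - f u\<bar> > real n * (v - u)"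
        using x(2) unfolding frequent_points_def by blast
      then show ?thesis by (intro exI[of _ u] exI[of _ v]) auto
    qed
    have half: "?m F / 2 > 0" using pos by simp
    obtain D where D: "D division_of \<Union>D" "disjoint D" "\<Union>D \<subseteq> W"
      "\<And>k. k \<in> D \<Longrightarrow> Inf k < Sup k \<and> \<bar>f (Sup k) - f (Inf k)\<bar> > real n * (Sup k - Inf k)"
      "?m (F - \<Union>D) < ?m F / 2"
      by (rule Vitali_intervals[OF fmeasurableD[OF Fm] W(3,1,2) fine half]) (assumption+, blast)
    define L where "L = (\<Sum>k\<in>D. Sup k - Inf k)"
    note mD = measure_division[OF D(1)]
    have "?m F \<le> ?m (\<Union>D \<union> (F - \<Union>D))"
      using Fm mD(2) by (intro measure_mono_fmeasurable fmeasurable.Un fmeasurable_Diff) (auto intro: fmeasurableD)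
    also have "\<dots> \<le> ?m (\<Union>D) + ?m (F - \<Union>D)"
      using Fm mD(2) by (intro measure_Un_le) (auto intro!: fmeasurableD fmeasurable_Diff)
    finally have L1: "?m F / 2 < L" using D(5) mD(1) by (simp add: L_def)
    have "L \<le> ?m (ball c (\<delta>/3))" unfolding L_def mD(1)[symmetric]
      using D(3) W(5) mD(2) by (intro measure_mono_fmeasurable) auto
    also have "\<dots> \<le> 2 * \<delta> / 3" using d by (simp add: ball_eq_greaterThanLessThan)
    finally have "L < \<delta>" using d by simp
    moreover have "sum (measure lborel) D = L" unfolding L_def
      using division_real_interval(3)[OF D(1)] by (intro sum.cong) auto
    moreover have "\<Union>D \<subseteq> {a..b}" by (rule order_trans[OF D(3) order_trans[OF W(4)]]) auto
    ultimately have "(\<Sum>k\<in>D. norm (f (Sup k) - f (Inf k))) < 1" using ac'[OF D(1)] by simp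
    moreover have "real n * L \<le> (\<Sum>k\<in>D. norm (f (Sup k) - f (Inf k)))"
      unfolding L_def sum_distrib_left using D(4) by (intro sum_mono) (auto intro: less_imp_le)
    moreover have "real n * (?m F / 2) \<le> real n * L" using L1 by (intro mult_left_mono) auto
    moreover have "real n * (?m F / 2) > 1" using n pos by (simp add: field_simps)
    ultimately show False by linarith
  qed
  have "negligible E" unfolding locally_negligible_alt[of E]
  proof
    fix x assume "x \<in> E"
    then show "\<exists>U. openin (top_of_set E) U \<and> x \<in> U \<and> negligible U"
      using local[of x] d by (intro exI[of _ "E \<inter> ball x (\<delta>/3)"]) (auto intro: openin_open_Int)
  qed
  then show ?thesis by (simp add: E_def)
qed

text \<open>A bound for intervals that straddle \<open>x\<close> extends to intervals with \<open>x\<close> as an endpoint by letting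
  the other endpoint tend to \<open>x\<close>. This converts statements about \<open>frequent_points\<close> into the
  difference quotients that define the derivative.\<close>

lemma slope_bound_at_continuity_point:
  fixes f :: "real \<Rightarrow> real"
  assumes cont: "isCont f x" and x: "a < x" "x < b" and d: "d > 0"
    and sl: "\<And>u v. \<lbrakk>a \<le> u; u < x; x < v; v \<le> b; v - u < d\<rbrakk> \<Longrightarrow> \<bar>f v - f u - L * (v - u)\<bar> \<le> \<epsilon> * (v - u)"
    and y: "\<bar>y - x\<bar> < d" "a \<le> y" "y \<le> b"
  shows "\<bar>f y - f x - L * (y - x)\<bar> \<le> \<epsilon> * \<bar>y - x\<bar>"
proof (cases y x rule: linorder_cases)
  case greater
  have f1: "(f \<longlongrightarrow> f x) (at_left x)" using cont by (meson isContD tendsto_mono at_le subset_UNIV)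
  have "\<bar>f y - f x - L * (y - x)\<bar> - \<epsilon> * (y - x) \<le> 0"
  proof (rule tendsto_upperbound)
    show "((\<lambda>u. \<bar>f y - f u - L * (y - u)\<bar> - \<epsilon> * (y - u)) \<longlongrightarrow> \<bar>f y - f x - L * (y - x)\<bar> - \<epsilon> * (y - x)) (at_left x)"
      by (intro tendsto_intros f1)
    have "max a (y - d) < x" using x y by auto
    then have "eventually (\<lambda>u. u \<in> {max a (y - d)<..<x}) (at_left x)" by (rule eventually_at_leftI[rotated]) auto
    then show "eventually (\<lambda>u. \<bar>f y - f u - L * (y - u)\<bar> - \<epsilon> * (y - u) \<le> 0) (at_left x)"
    proof eventually_elim
      case (elim u) then show ?case using sl[of u y] greater y by auto
    qed
  qed (rule trivial_limit_at_left_real)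
  then show ?thesis using greater by simp
next
  case less
  have f1: "(f \<longlongrightarrow> f x) (at_right x)" using cont by (meson isContD tendsto_mono at_le subset_UNIV)
  have "\<bar>f x - f y - L * (x - y)\<bar> - \<epsilon> * (x - y) \<le> 0"
  proof (rule tendsto_upperbound)
    show "((\<lambda>v. \<bar>f v - f y - L * (v - y)\<bar> - \<epsilon> * (v - y)) \<longlongrightarrow> \<bar>f x - f y - L * (x - y)\<bar> - \<epsilon> * (x - y)) (at_right x)"
      by (intro tendsto_intros f1)
    have "x < min b (y + d)" using x y by auto
    then have "eventually (\<lambda>u. u \<in> {x<..<min b (y + d)}) (at_right x)" by (rule eventually_at_rightI[rotated]) auto
    then show "eventually (\<lambda>v. \<bar>f v - f y - L * (v - y)\<bar> - \<epsilon> * (v - y) \<le> 0) (at_right x)"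
    proof eventually_elim
      case (elim v) then show ?case using sl[of y v] less y by auto
    qed
  qed (rule trivial_limit_at_right_real)
  moreover have "\<bar>f x - f y - L * (x - y)\<bar> = \<bar>f y - f x - L * (y - x)\<bar>" by (simp add: algebra_simps abs_if)
  ultimately show ?thesis using less by simp
qed simp

text \<open>The exceptional set consists of the points of unbounded slope and, for each of the countably
  many rational pairs \<open>r < s\<close>, the points where slopes below \<open>r\<close> and above \<open>s\<close> both keep occurring.
  Elsewhere the lower derivative \<open>L\<close>, the supremum of all \<open>r\<close> that eventually bound the slopes from
  below, is finite. Any rational just above \<open>L\<close> fails to bound the slopes from below, so the slopes
  are eventually below every slightly larger rational, and \<open>L\<close> is the derivative.\<close>

lemma ac_real_differentiable_ae:
  fixes f :: "real \<Rightarrow> real"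
  assumes ac: "abs_cont_on {a..b} f"
  shows "negligible {x \<in> {a<..<b}. \<not> f differentiable (at x)}"
proof -
  let ?Lo = "\<lambda>r. frequent_points a b (\<lambda>u v. f v - f u < r * (v - u))"
  let ?Hi = "\<lambda>s. frequent_points a b (\<lambda>u v. f v - f u > s * (v - u))"
  let ?Inf = "\<Inter>n::nat. frequent_points a b (\<lambda>u v. \<bar>f v - f u\<bar> > real n * (v - u))"
  define G where "G = (\<lambda>(r,s). ?Lo r \<inter> ?Hi s) ` {(r,s). r \<in> \<rat> \<and> s \<in> \<rat> \<and> r < s}"
  have "countable {(r,s). r \<in> (\<rat>::real set) \<and> s \<in> (\<rat>::real set) \<and> r < s}"
    by (rule countable_subset[of _ "\<rat> \<times> \<rat>"]) (auto intro: countable_rat)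
  then have "countable G" unfolding G_def by (rule countable_image)
  then have "negligible (\<Union>G)"
    using ac_slope_gap_negligible[OF ac] by (intro negligible_countable_Union) (auto simp: G_def)
  then have neg: "negligible (?Inf \<union> \<Union>G)"
    using ac_unbounded_slope_negligible[OF ac] by (intro negligible_Un)
  have diff: "f differentiable (at x)" if x: "x \<in> {a<..<b}" and nI: "x \<notin> ?Inf" and nG: "x \<notin> \<Union>G" for x
  proof -
    have ab: "a < x" "x < b" using x by auto
    have "continuous_on {a<..<b} f"
      by (rule continuous_on_subset[OF abs_cont_on_imp_continuous_on[OF ac]]) (auto simp: is_interval_cc)
    then have cont: "isCont f x" using x by (simp add: continuous_on_eq_continuous_at)
    obtain n :: nat where n: "x \<notin> frequent_points a b (\<lambda>u v. \<bar>f v - f u\<bar> > real n * (v - u))"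
      using nI by blast
    obtain d0 where d0: "d0 > 0" and bd': "\<And>u v. \<lbrakk>a \<le> u; u < x; x < v; v \<le> b; v - u < d0\<rbrakk>
        \<Longrightarrow> \<not> \<bar>f v - f u\<bar> > real n * (v - u)" by (rule not_frequent_pointsE[OF n]) blast
    note bd = bd'[unfolded not_less]
    define S where "S = {r. x \<notin> ?Lo r}"
    have Sd: "\<exists>d>0. \<forall>u v. a \<le> u \<and> u < x \<and> x < v \<and> v \<le> b \<and> v - u < d \<longrightarrow> r * (v - u) \<le> f v - f u"
      if r: "r \<in> S" for r
    proof -
      have "x \<notin> ?Lo r" using r by (simp add: S_def)
      then obtain d where "d > 0" "\<And>u v. \<lbrakk>a \<le> u; u < x; x < v; v \<le> b; v - u < d\<rbrakk> \<Longrightarrow> \<not> f v - f u < r * (v - u)"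
        by (rule not_frequent_pointsE) blast
      then show ?thesis unfolding not_less by blast
    qed
    \<comment> \<open>Bounded slopes: \<open>S\<close> is nonempty and bounded above, so that \<open>L = Sup S\<close> makes sense.\<close>
    have "x \<notin> ?Lo (- real n)"
    proof
      assume "x \<in> ?Lo (- real n)"
      then obtain u v where uv: "a \<le> u" "u < x" "x < v" "v \<le> b" "v - u < d0" "f v - f u < - real n * (v - u)"
        unfolding frequent_points_def using d0 by blast
      then show False using bd[OF uv(1-5)] by auto
    qed
    then have "- real n \<in> S" by (simp add: S_def)
    have bdd: "r \<le> real n" if r: "r \<in> S" for r
    proof -
      obtain d1 where d1: "d1 > 0" "\<And>u v. \<lbrakk>a \<le> u; u < x; x < v; v \<le> b; v - u < d1\<rbrakk> \<Longrightarrow> r * (v - u) \<le> f v - f u"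
        using Sd[OF r] by blast
      define \<eta> where "\<eta> = min (min (x - a) (b - x)) (min d0 d1 / 3)"
      have \<eta>: "\<eta> > 0" "\<eta> \<le> x - a" "\<eta> \<le> b - x" "2 * \<eta> < d0" "2 * \<eta> < d1"
        using ab d0 d1(1) by (auto simp: \<eta>_def min_def)
      have "\<bar>f (x + \<eta>) - f (x - \<eta>)\<bar> \<le> real n * (2 * \<eta>)" using bd[of "x - \<eta>" "x + \<eta>"] \<eta> by simp
      moreover have "r * (2 * \<eta>) \<le> f (x + \<eta>) - f (x - \<eta>)" using d1(2)[of "x - \<eta>" "x + \<eta>"] \<eta> by simp
      ultimately have "r * (2 * \<eta>) \<le> real n * (2 * \<eta>)" by linarith
      then show ?thesis using \<eta> by simp
    qed
    have bddS: "bdd_above S" using bdd by (intro bdd_aboveI[of _ "real n"]) auto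
    define L where "L = Sup S"
    have "(f has_derivative (\<lambda>h. L * h)) (at x)"
      unfolding has_derivative_at_alt
    proof (intro conjI allI impI)
      show "bounded_linear ((*) L)" by (rule bounded_linear_mult_right)
      fix \<epsilon> :: real assume e: "\<epsilon> > 0"
      obtain r where r: "r \<in> S" "L - \<epsilon> < r"
        using less_cSup_iff[of S "L - \<epsilon>"] bddS \<open>- real n \<in> S\<close> e unfolding L_def by auto
      obtain p where p: "p \<in> \<rat>" "L < p" "p < L + \<epsilon>" using Rats_dense_in_real[of L "L + \<epsilon>"] e by auto
      obtain q where q: "q \<in> \<rat>" "p < q" "q < L + \<epsilon>" using Rats_dense_in_real[of p "L + \<epsilon>"] p by auto
      have "p \<notin> S" using p(2) bddS cSup_upper[of p S] unfolding L_def by auto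
      then have "x \<in> ?Lo p" by (simp add: S_def)
      moreover have "?Lo p \<inter> ?Hi q \<in> G" unfolding G_def using p q by auto
      ultimately have "x \<notin> ?Hi q" using nG by blast
      then obtain d2 where d2: "d2 > 0"
        and d2': "\<And>u v. \<lbrakk>a \<le> u; u < x; x < v; v \<le> b; v - u < d2\<rbrakk> \<Longrightarrow> \<not> f v - f u > q * (v - u)"
        by (rule not_frequent_pointsE) blast
      obtain d1 where d1: "d1 > 0" "\<And>u v. \<lbrakk>a \<le> u; u < x; x < v; v \<le> b; v - u < d1\<rbrakk> \<Longrightarrow> r * (v - u) \<le> f v - f u"
        using Sd[OF r(1)] by blast
      have sl: "\<bar>f v - f u - L * (v - u)\<bar> \<le> \<epsilon> * (v - u)"
        if uv: "a \<le> u" "u < x" "x < v" "v \<le> b" "v - u < min d1 d2" for u v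
      proof -
        have "(L - \<epsilon>) * (v - u) \<le> r * (v - u)" "q * (v - u) \<le> (L + \<epsilon>) * (v - u)"
          using r(2) q(3) uv by (intro mult_right_mono; simp)+
        then show ?thesis using d1(2)[of u v] d2'[of u v] uv by (simp add: algebra_simps abs_le_iff)
      qed
      have "min d1 d2 > 0" using d1 d2 by simp
      note * = slope_bound_at_continuity_point[OF cont ab this sl]
      show "\<exists>d>0. \<forall>y. norm (y - x) < d \<longrightarrow> norm (f y - f x - L * (y - x)) \<le> \<epsilon> * norm (y - x)"
        using * ab d1(1) d2(1) by (intro exI[of _ "min (min d1 d2) (min (x - a) (b - x))"]) (auto simp: abs_less_iff)
    qed
    then show ?thesis unfolding differentiable_def by blast
  qed
  show ?thesis by (rule negligible_subset[OF neg]) (use diff in blast)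
qed

lemma ac_differentiable_ae:
  fixes f :: "real \<Rightarrow> 'a::euclidean_space"
  assumes ac: "abs_cont_on {a..b} f"
  shows "negligible {x \<in> {a<..<b}. \<not> f differentiable (at x)}"
proof (rule negligible_subset)
  show "negligible (\<Union>i\<in>Basis. {x \<in> {a<..<b}. \<not> (\<lambda>t. f t \<bullet> i) differentiable (at x)})"
  proof (rule negligible_Union)
    fix T assume "T \<in> (\<lambda>i. {x \<in> {a<..<b}. \<not> (\<lambda>t. f t \<bullet> i) differentiable (at x)}) ` Basis"
    then obtain i where i: "i \<in> Basis" "T = {x \<in> {a<..<b}. \<not> (\<lambda>t. f t \<bullet> i) differentiable (at x)}"
      by blast
    have "norm (f x \<bullet> i - f y \<bullet> i) \<le> norm (f x - f y)" for x y
      using Basis_le_norm[OF i(1), of "f x - f y"] by (simp add: inner_diff_left)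
    then have "abs_cont_on {a..b} (\<lambda>t. f t \<bullet> i)" by (rule abs_cont_on_norm_le[OF ac])
    then show "negligible T" unfolding i(2) by (rule ac_real_differentiable_ae)
  qed simp
  show "{x \<in> {a<..<b}. \<not> f differentiable (at x)} \<subseteq> (\<Union>i\<in>Basis. {x \<in> {a<..<b}. \<not> (\<lambda>t. f t \<bullet> i) differentiable (at x)})"
    using differentiable_componentwise_within[of f _ UNIV] by auto
qed

section \<open>The fundamental theorem of calculus for absolutely continuous functions\<close>

text \<open>The integrand may be taken to vanish on \<open>N\<close>. At points outside \<open>N\<close> the gauge is the usual one
  from the definition of the derivative. At points of \<open>N\<close> it is an open set \<open>T \<supseteq> N\<close> of measure
  below the tolerance of absolute continuity, so that the intervals tagged in \<open>N\<close> carry a negligible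
  part of the increment of \<open>f\<close>.\<close>

lemma fundamental_theorem_of_calculus_ae:
  fixes f :: "real \<Rightarrow> 'a::euclidean_space"
  assumes ac: "abs_cont_on {a..b} f" and ab: "a \<le> b" and N: "negligible N"
    and f': "\<And>x. x \<in> {a..b} - N \<Longrightarrow> (f has_vector_derivative f' x) (at x)"
  shows "(f' has_integral (f b - f a)) {a..b}"
proof -
  define g where "g = (\<lambda>x. if x \<in> N then 0 else f' x)"
  have "(g has_integral (f b - f a)) {a..b}"
    unfolding has_integral_real
  proof (intro allI impI)
    fix e :: real assume e: "e > 0"
    then have e2: "e/2 > 0" by simp
    define e' where "e' = e / (2 * (b - a + 1))"
    have e': "e' > 0" "e' * (b - a) < e / 2" using e ab by (auto simp: e'_def field_simps)
    from abs_cont_on_division[OF ac e2] obtain \<delta> where d: "\<delta> > 0"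
      and ac': "\<And>D. \<lbrakk>D division_of \<Union>D; \<Union>D \<subseteq> {a..b}; sum (measure lborel) D < \<delta>\<rbrakk>
         \<Longrightarrow> (\<Sum>k\<in>D. norm (f (Sup k) - f (Inf k))) < e/2" by blast
    have N0: "N \<in> null_sets lebesgue" using N by (simp add: negligible_iff_null_sets)
    obtain T where T: "open T" "N \<subseteq> T" "T - N \<in> lmeasurable" "emeasure lebesgue (T - N) < ennreal \<delta>"
      using sets_lebesgue_outer_open[of N \<delta>] N0 d by blast
    have Tm: "T \<in> lmeasurable"
      using fmeasurable.Un[OF negligible_imp_measurable[OF N] T(3)] T(2) by (simp add: Un_absorb1)
    have mT: "measure lebesgue T < \<delta>"
    proof -
      have "measure lebesgue T = measure lebesgue (T - N)"
        using Tm N0 by (simp add: measure_Diff_null_set fmeasurableD)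
      also have "\<dots> < \<delta>" using T(3,4) d by (simp add: emeasure_eq_measure2 ennreal_less_iff)
      finally show ?thesis .
    qed
    have "\<exists>r>0. \<forall>y. norm (y - x) < r \<longrightarrow> norm (f y - f x - (y - x) *\<^sub>R f' x) \<le> e' * norm (y - x)"
      if "x \<in> {a..b} - N" for x
      using f'[OF that] e'(1) unfolding has_vector_derivative_def has_derivative_at_alt by blast
    then obtain r where r: "\<And>x. x \<in> {a..b} - N \<Longrightarrow> r x > 0"
      "\<And>x y. x \<in> {a..b} - N \<Longrightarrow> norm (y - x) < r x \<Longrightarrow>
         norm (f y - f x - (y - x) *\<^sub>R f' x) \<le> e' * norm (y - x)"
      by metis
    define \<gamma> where "\<gamma> = (\<lambda>x. if x \<in> N then T else if x \<in> {a..b} then ball x (r x) else ball x 1)"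
    have gauge: "gauge \<gamma>" unfolding gauge_def \<gamma>_def using T(1,2) r(1) by auto
    have close: "norm ((\<Sum>(x,k)\<in>p. measure lborel k *\<^sub>R g x) - (f b - f a)) < e"
      if p: "p tagged_division_of {a..b}" and fine: "\<gamma> fine p" for p
    proof -
      note pD = tagged_division_ofD[OF p]
      let ?d = "\<lambda>k::real set. f (Sup k) - f (Inf k)"
      define p1 where "p1 = {xk\<in>p. fst xk \<in> N}"
      define p2 where "p2 = {xk\<in>p. fst xk \<notin> N}"
      have pp: "p = p1 \<union> p2" "p1 \<inter> p2 = {}" "finite p1" "finite p2"
        using pD(1) by (auto simp: p1_def p2_def)
      have "(\<Sum>(x,k)\<in>p. measure lborel k *\<^sub>R g x) - (f b - f a) = (\<Sum>(x,k)\<in>p. measure lborel k *\<^sub>R g x - ?d k)"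
        using additive_tagged_division_1[OF ab p, of f] by (simp add: sum_subtractf case_prod_unfold)
      also have "\<dots> = (\<Sum>(x,k)\<in>p1. measure lborel k *\<^sub>R g x - ?d k) + (\<Sum>(x,k)\<in>p2. measure lborel k *\<^sub>R g x - ?d k)"
        unfolding pp(1) using pp(2-4) by (intro sum.union_disjoint)
      finally have split: "norm ((\<Sum>(x,k)\<in>p. measure lborel k *\<^sub>R g x) - (f b - f a))
        \<le> norm (\<Sum>(x,k)\<in>p1. measure lborel k *\<^sub>R g x - ?d k) + norm (\<Sum>(x,k)\<in>p2. measure lborel k *\<^sub>R g x - ?d k)"
        by (simp add: norm_triangle_ineq)
      have "norm (\<Sum>(x,k)\<in>p2. measure lborel k *\<^sub>R g x - ?d k) \<le> (\<Sum>(x,k)\<in>p2. e' * measure lborel k)"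
      proof (rule sum_norm_le, clarify)
        fix x k assume xk: "(x,k) \<in> p2"
        then have xkp: "(x,k) \<in> p" "x \<notin> N" by (auto simp: p2_def)
        obtain u v where k: "k = {u..v}" using pD(4)[OF xkp(1)] by auto
        have x: "x \<in> {u..v}" "x \<in> {a..b}" using pD(2,3)[OF xkp(1)] k by auto
        have "{u..v} \<subseteq> ball x (r x)" using fineD[OF fine xkp(1)] xkp(2) x by (simp add: \<gamma>_def k)
        moreover have "u \<in> {u..v}" "v \<in> {u..v}" using x by auto
        ultimately have "u \<in> ball x (r x)" "v \<in> ball x (r x)" by blast+
        then have "norm (u - x) < r x" "norm (v - x) < r x"
          by (auto simp: dist_norm norm_minus_commute)
        with r(2)[of x u] r(2)[of x v] x xkp(2)
        have 1: "norm (f u - f x - (u - x) *\<^sub>R f' x) \<le> e' * (x - u)"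
          and 2: "norm (f v - f x - (v - x) *\<^sub>R f' x) \<le> e' * (v - x)" by auto
        have "measure lborel k *\<^sub>R g x - ?d k =
          (f u - f x - (u - x) *\<^sub>R f' x) - (f v - f x - (v - x) *\<^sub>R f' x)"
          using x xkp(2) by (simp add: k g_def algebra_simps)
        also have "norm \<dots> \<le> e' * (x - u) + e' * (v - x)"
          by (intro order_trans[OF norm_triangle_ineq4] add_mono 1 2)
        also have "\<dots> = e' * measure lborel k" using x by (simp add: k algebra_simps)
        finally show "norm (measure lborel k *\<^sub>R g x - ?d k) \<le> e' * measure lborel k" .
      qed
      also have "\<dots> \<le> (\<Sum>(x,k)\<in>p. e' * measure lborel k)"
        using pD(1) e'(1) by (intro sum_mono2) (auto simp: p2_def)
      also have "\<dots> = e' * (b - a)"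
        using additive_content_tagged_division[of p a b] p ab
        by (simp add: sum_distrib_left[symmetric] case_prod_unfold)
      also have "\<dots> < e/2" by (rule e'(2))
      finally have B2: "norm (\<Sum>(x,k)\<in>p2. measure lborel k *\<^sub>R g x - ?d k) < e/2" .
      have p1t: "p1 tagged_division_of \<Union>(snd ` p1)"
        by (rule tagged_partial_division_of_Union_self[OF tagged_partial_division_subset[of p]])
          (use p in \<open>auto simp: p1_def tagged_division_of_def\<close>)
      have D: "snd ` p1 division_of \<Union>(snd ` p1)" by (rule division_of_tagged_division[OF p1t])
      \<comment> \<open>The empty interval is singled out because its supremum and infimum are unspecified values.\<close>
      have "norm (\<Sum>(x,k)\<in>p1. measure lborel k *\<^sub>R g x - ?d k) \<le> (\<Sum>(x,k)\<in>p1. if k = {} then 0 else norm (?d k))"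
      proof (rule sum_norm_le, clarify)
        fix x k assume "(x,k) \<in> p1"
        then have "g x = 0" "k \<noteq> {}" using pD(2) by (auto simp: p1_def g_def)
        then show "norm (measure lborel k *\<^sub>R g x - ?d k) \<le> (if k = {} then 0 else norm (?d k))"
          by (simp add: norm_minus_commute)
      qed
      also have "\<dots> = (\<Sum>k\<in>snd ` p1. if k = {} then 0 else norm (?d k))"
      proof (rule sum.over_tagged_division_lemma[OF p1t])
        fix u v :: real assume "box u v = {}"
        then show "(if cbox u v = {} then 0 else norm (?d (cbox u v))) = 0"
          by (cases "u = v") auto
      qed
      also have "\<dots> = (\<Sum>k\<in>snd ` p1. norm (?d k))"
        using division_ofD(3)[OF D] by (intro sum.cong) auto
      also have "\<dots> < e/2"
      proof (rule ac'[OF D])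
        show "\<Union>(snd ` p1) \<subseteq> {a..b}" using pD(3) by (fastforce simp: p1_def)
        have sub: "\<Union>(snd ` p1) \<subseteq> T" using fineD[OF fine] by (fastforce simp: p1_def \<gamma>_def)
        have "sum (measure lborel) (snd ` p1) = measure lebesgue (\<Union>(snd ` p1))"
          unfolding measure_division(1)[OF D] using division_real_interval(3)[OF D] by (intro sum.cong) auto
        also have "\<dots> \<le> measure lebesgue T"
          using measure_division(2)[OF D] Tm sub by (intro measure_mono_fmeasurable) auto
        finally show "sum (measure lborel) (snd ` p1) < \<delta>" using mT by simp
      qed
      finally have B1: "norm (\<Sum>(x,k)\<in>p1. measure lborel k *\<^sub>R g x - ?d k) < e/2" .
      show ?thesis using split B1 B2 by linarith
    qed
    show "\<exists>\<gamma>. gauge \<gamma> \<and> (\<forall>p. p tagged_division_of {a..b} \<and> \<gamma> fine p \<longrightarrow>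
        norm ((\<Sum>(x,k)\<in>p. measure lborel k *\<^sub>R g x) - (f b - f a)) < e)"
      by (intro exI[of _ \<gamma>] conjI allI impI gauge close) auto
  qed
  then show ?thesis by (rule has_integral_spike[OF N, rotated]) (simp add: g_def)
qed

lemma ac_fundamental_theorem_of_calculus:
  fixes f :: "real \<Rightarrow> 'a::euclidean_space"
  assumes ac: "abs_cont_on {a..b} f" and ab: "a \<le> b"
  shows "((\<lambda>s. vector_derivative f (at s)) has_integral (f b - f a)) {a..b}"
proof (rule fundamental_theorem_of_calculus_ae[OF ac ab])
  show "negligible ({a,b} \<union> {x \<in> {a<..<b}. \<not> f differentiable (at x)})"
    by (intro negligible_Un ac_differentiable_ae[OF ac] negligible_finite) auto
  show "(f has_vector_derivative vector_derivative f (at x)) (at x)"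
    if "x \<in> {a..b} - ({a,b} \<union> {x \<in> {a<..<b}. \<not> f differentiable (at x)})" for x
    using that by (subst vector_derivative_works[symmetric]) auto
qed

section \<open>Fractional kernels\<close>

text \<open>The substitution \<open>r = s + (t - s) * u\<close> turns the integral into the Beta integral
  \<open>B(1 - \<alpha>, \<alpha>) = \<Gamma>(1 - \<alpha>) * \<Gamma>(\<alpha>)\<close>; the powers of \<open>t - s\<close> cancel.\<close>

lemma Beta_kernel:
  fixes \<alpha> s t :: real
  assumes \<alpha>: "0 < \<alpha>" "\<alpha> < 1" and st: "s < t"
  defines "k \<equiv> \<lambda>r. indicator {s..t} r * ((t - r) powr (\<alpha> - 1) * (r - s) powr (- \<alpha>))"
  shows "integrable lborel k" "integral\<^sup>L lborel k = Gamma \<alpha> * Gamma (1 - \<alpha>)"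
proof -
  define k0 :: "real \<Rightarrow> real" where "k0 = (\<lambda>u. indicator {0..1} u * (u powr (- \<alpha>) * (1 - u) powr (\<alpha> - 1)))"
  have I: "set_integrable lborel {0..1} (\<lambda>u. u powr ((1 - \<alpha>) - 1) * (1 - u) powr (\<alpha> - 1))"
    by (rule integrable_Beta) (use \<alpha> in auto)
  then have k0: "integrable lborel k0" by (simp add: set_integrable_def k0_def)
  have "integral\<^sup>L lborel k0 = integral {0..1} (\<lambda>u. u powr ((1 - \<alpha>) - 1) * (1 - u) powr (\<alpha> - 1))"
    using set_borel_integral_eq_integral(2)[OF I] by (simp add: set_lebesgue_integral_def k0_def)
  also have "\<dots> = Beta (1 - \<alpha>) \<alpha>"
    by (rule integral_unique[OF has_integral_Beta_real]) (use \<alpha> in auto)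
  also have "\<dots> = Gamma \<alpha> * Gamma (1 - \<alpha>)" by (simp add: Beta_def mult.commute)
  finally have i0: "integral\<^sup>L lborel k0 = Gamma \<alpha> * Gamma (1 - \<alpha>)" .
  have eq: "k (s + (t - s) * u) = k0 u / (t - s)" for u
  proof (cases "u \<in> {0..1}")
    case True
    then have u: "0 \<le> u" "u \<le> 1" by auto
    have "t - (s + (t - s) * u) = (t - s) * (1 - u)" by (simp add: algebra_simps)
    moreover have "(t - s) * u \<le> (t - s) * 1" "0 \<le> (t - s) * u"
      using u st by (intro mult_left_mono mult_nonneg_nonneg; simp)+
    then have "s + (t - s) * u \<in> {s..t}" by simp
    moreover have "(t - s) powr (\<alpha> - 1) * (t - s) powr (- \<alpha>) = 1 / (t - s)"
      unfolding powr_add[symmetric] using st by (simp add: powr_neg_one)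
    ultimately show ?thesis using True u st
      by (simp add: k_def k0_def powr_mult mult_ac)
  next
    case False
    have "s + (t - s) * u \<notin> {s..t}"
    proof
      assume "s + (t - s) * u \<in> {s..t}"
      then have "(t - s) * 0 \<le> (t - s) * u" "(t - s) * u \<le> (t - s) * 1" by auto
      then have "0 \<le> u" "u \<le> 1" using st by (auto simp only: mult_le_cancel_left_pos diff_gt_0_iff_gt)
      with False show False by simp
    qed
    then show ?thesis using False by (simp add: k_def k0_def)
  qed
  have ts: "t - s \<noteq> 0" using st by simp
  have "integrable lborel (\<lambda>u. k (s + (t - s) * u))" unfolding eq using k0 by simp
  then show "integrable lborel k" using lborel_integrable_real_affine_iff[OF ts] by blast
  show "integral\<^sup>L lborel k = Gamma \<alpha> * Gamma (1 - \<alpha>)"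
    using lborel_integral_real_affine[OF ts, of k s] st i0 by (simp add: eq)
qed

text \<open>Exchange the order of integration over the triangle \<open>0 \<le> s \<le> r \<le> t\<close>. The inner integral over
  \<open>r\<close> is then \<open>Beta_kernel\<close>, a constant independent of \<open>s\<close>; this also shows absolute integrability,
  which Fubini's theorem needs. Only \<open>s = t\<close>, where the kernel degenerates, has to be excluded.\<close>

lemma Abel_inversion:
  fixes y :: "real \<Rightarrow> 'a::euclidean_space"
  assumes \<alpha>: "0 < \<alpha>" "\<alpha> < 1" and y[measurable]: "y \<in> borel_measurable borel"
    and int: "set_integrable lborel {0..t} y"
  defines "G \<equiv> \<lambda>r. (t - r) powr (\<alpha> - 1) *\<^sub>R (LINT s:{0..r}|lborel. (r - s) powr (- \<alpha>) *\<^sub>R y s)"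
  shows "set_integrable lborel {0..t} G"
    and "(LINT r:{0..t}|lborel. G r) = (Gamma \<alpha> * Gamma (1 - \<alpha>)) *\<^sub>R (LINT s:{0..t}|lborel. y s)"
proof -
  define B where "B = Gamma \<alpha> * Gamma (1 - \<alpha>)"
  have B: "B > 0" using \<alpha> by (simp add: B_def)
  define F where "F = (\<lambda>s r. (if 0 \<le> s \<and> s \<le> r \<and> r \<le> t then (t - r) powr (\<alpha> - 1) * (r - s) powr (- \<alpha>) else 0) *\<^sub>R y s)"
  have Fm[measurable]: "case_prod F \<in> borel_measurable (lborel \<Otimes>\<^sub>M lborel)"
    unfolding F_def by measurable
  define k where "k = (\<lambda>s r. indicator {s..t} r * ((t - r) powr (\<alpha> - 1) * (r - s) powr (- \<alpha>)))"
  have Fk: "F s r = k s r *\<^sub>R (indicator {0..t} s *\<^sub>R y s)" for s r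
    by (auto simp: F_def k_def indicator_def)
  have k: "integrable lborel (k s)" "integral\<^sup>L lborel (k s) = B" if "s < t" for s
    unfolding k_def B_def using Beta_kernel[OF \<alpha> that] by auto
  have k0: "k s r \<ge> 0" for s r by (simp add: k_def)
  have 1: "integrable lborel (\<lambda>r. F s r)" "(\<integral>r. norm (F s r) \<partial>lborel) = B * norm (indicator {0..t} s *\<^sub>R y s)"
    "(\<integral>r. F s r \<partial>lborel) = B *\<^sub>R (indicator {0..t} s *\<^sub>R y s)"
    if "s \<noteq> t" for s
  proof -
    have "integrable lborel (\<lambda>r. F s r) \<and> (\<integral>r. norm (F s r) \<partial>lborel) = B * norm (indicator {0..t} s *\<^sub>R y s)
      \<and> (\<integral>r. F s r \<partial>lborel) = B *\<^sub>R (indicator {0..t} s *\<^sub>R y s)"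
    proof (cases "s < t")
      case True
      have "norm (F s r) = k s r * norm (indicator {0..t} s *\<^sub>R y s)" for r
        unfolding Fk norm_scaleR using k0[of s r] by simp
      then have "(\<integral>r. norm (F s r) \<partial>lborel) = B * norm (indicator {0..t} s *\<^sub>R y s)"
        using k[OF True] by (simp only: integral_mult_left_zero)
      moreover have "integrable lborel (\<lambda>r. F s r)" "(\<integral>r. F s r \<partial>lborel) = B *\<^sub>R (indicator {0..t} s *\<^sub>R y s)"
        using k[OF True] unfolding Fk by simp_all
      ultimately show ?thesis by blast
    next
      case False
      then have "s \<notin> {0..t}" using that by auto
      then have "F s r = 0" for r by (auto simp: F_def)
      then show ?thesis using \<open>s \<notin> {0..t}\<close> by simp
    qed
    then show "integrable lborel (\<lambda>r. F s r)" "(\<integral>r. norm (F s r) \<partial>lborel) = B * norm (indicator {0..t} s *\<^sub>R y s)"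
      "(\<integral>r. F s r \<partial>lborel) = B *\<^sub>R (indicator {0..t} s *\<^sub>R y s)" by auto
  qed
  have ae: "AE s in lborel. s \<noteq> t" by (rule AE_lborel_singleton)
  have int': "integrable lborel (\<lambda>s. indicator {0..t} s *\<^sub>R y s)" using int by (simp add: set_integrable_def)
  have Fint: "integrable (lborel \<Otimes>\<^sub>M lborel) (case_prod F)"
  proof (rule lborel_pair.Fubini_integrable[OF Fm])
    have "integrable lborel (\<lambda>s. B * norm (indicator {0..t} s *\<^sub>R y s))"
      by (intro integrable_mult_right integrable_norm int')
    then show "integrable lborel (\<lambda>s. \<integral>r. norm (case_prod F (s, r)) \<partial>lborel)"
    proof (rule integrable_cong_AE_imp)
      show "(\<lambda>s. \<integral>r. norm (case_prod F (s, r)) \<partial>lborel) \<in> borel_measurable lborel" by measurable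
      show "AE s in lborel. B * norm (indicator {0..t} s *\<^sub>R y s) = (\<integral>r. norm (case_prod F (s, r)) \<partial>lborel)"
        using ae by eventually_elim (simp add: 1(2))
    qed
    show "AE s in lborel. integrable lborel (\<lambda>r. case_prod F (s, r))"
      using ae by eventually_elim (simp add: 1(1))
  qed
  have G: "(\<integral>s. F s r \<partial>lborel) = indicator {0..t} r *\<^sub>R G r" for r
  proof -
    have "F s r = (indicator {0..t} r * (t - r) powr (\<alpha> - 1)) *\<^sub>R (indicator {0..r} s *\<^sub>R (r - s) powr (- \<alpha>) *\<^sub>R y s)" for s
      by (auto simp: F_def indicator_def)
    then have "(\<integral>s. F s r \<partial>lborel) = (indicator {0..t} r * (t - r) powr (\<alpha> - 1)) *\<^sub>R
        (\<integral>s. indicator {0..r} s *\<^sub>R (r - s) powr (- \<alpha>) *\<^sub>R y s \<partial>lborel)"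
      by (simp only: Bochner_Integration.integral_scaleR_right)
    then show ?thesis by (simp only: G_def set_lebesgue_integral_def scaleR_scaleR)
  qed
  have "integrable lborel (\<lambda>r. \<integral>s. F s r \<partial>lborel)" using lborel_pair.integrable_snd[OF Fint] .
  then show "set_integrable lborel {0..t} G" unfolding G set_integrable_def .
  have "(\<integral>r. (\<integral>s. F s r \<partial>lborel) \<partial>lborel) = (\<integral>s. (\<integral>r. F s r \<partial>lborel) \<partial>lborel)"
    by (rule lborel_pair.Fubini_integral[OF Fint])
  also have "\<dots> = (\<integral>s. B *\<^sub>R (indicator {0..t} s *\<^sub>R y s) \<partial>lborel)"
  proof (rule integral_cong_AE)
    show "(\<lambda>s. \<integral>r. F s r \<partial>lborel) \<in> borel_measurable lborel" by measurable
    show "AE s in lborel. (\<integral>r. F s r \<partial>lborel) = B *\<^sub>R (indicator {0..t} s *\<^sub>R y s)"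
      using ae by eventually_elim (simp add: 1(3))
  qed measurable
  finally show "(LINT r:{0..t}|lborel. G r) = (Gamma \<alpha> * Gamma (1 - \<alpha>)) *\<^sub>R (LINT s:{0..t}|lborel. y s)"
    unfolding G set_lebesgue_integral_def B_def Bochner_Integration.integral_scaleR_right .
qed

text \<open>Extending the range of integration to \<open>r \<le> t\<close> and substituting \<open>u = \<mu> * (t - r)\<close> gives exactly
  the Gamma integral. The negative power of \<open>\<mu>\<close> is what the final absorption argument lives on.\<close>

lemma exponential_kernel:
  fixes \<alpha> \<mu> t :: real
  assumes \<alpha>: "0 < \<alpha>" and l: "\<mu> > 0"
  shows "set_integrable lborel {0..t} (\<lambda>r. (t - r) powr (\<alpha> - 1) * exp (\<mu> * r))" (is ?I)
    and "(LINT r:{0..t}|lborel. (t - r) powr (\<alpha> - 1) * exp (\<mu> * r)) \<le> Gamma \<alpha> * \<mu> powr (- \<alpha>) * exp (\<mu> * t)"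
proof -
  define g :: "real \<Rightarrow> real" where "g = (\<lambda>u. indicator {0..} u * u powr (\<alpha> - 1) / exp u)"
  have gm: "g \<in> borel_measurable lborel" unfolding g_def by measurable
  have g0: "g u \<ge> 0" for u by (simp add: g_def)
  have nn: "nn_integral lborel (\<lambda>u. ennreal (g u)) = ennreal (Gamma \<alpha>)"
    unfolding g_def using Gamma_conv_nn_integral_real[OF \<alpha>] by simp
  have gi: "integrable lborel g"
    by (rule integrableI_nn_integral_finite[OF gm _ nn]) (simp add: g0)
  have gI: "integral\<^sup>L lborel g = Gamma \<alpha>"
    by (rule integral_eq_nn_integral[THEN trans]) (use gm g0 nn \<alpha> in \<open>auto simp: Gamma_real_pos less_imp_le\<close>)
  define K where "K = (\<lambda>r. indicator {..t} r * ((t - r) powr (\<alpha> - 1) * exp (\<mu> * r)))"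
  define c where "c = \<mu> powr (\<alpha> - 1) * exp (- \<mu> * t)"
  have c: "c > 0" using l by (simp add: c_def)
  have eq: "g (\<mu> * t + (- \<mu>) * r) = c * K r" for r
  proof -
    have "\<mu> * t + (- \<mu>) * r = \<mu> * (t - r)" by (simp add: algebra_simps)
    moreover have "\<mu> * (t - r) \<ge> 0 \<longleftrightarrow> r \<le> t" using l by (simp add: zero_le_mult_iff)
    moreover have "1 / exp (\<mu> * (t - r)) = exp (- \<mu> * t) * exp (\<mu> * r)"
      by (simp add: exp_minus[symmetric] exp_add[symmetric] inverse_eq_divide[symmetric] algebra_simps)
    ultimately show ?thesis using l
      by (auto simp: g_def K_def c_def indicator_def powr_mult divide_inverse)
  qed
  have l0: "- \<mu> \<noteq> 0" using l by simp
  have "integrable lborel (\<lambda>r. c * K r)" using lborel_integrable_real_affine[OF gi l0, of "\<mu> * t"] unfolding eq .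
  then have Ki: "integrable lborel K" using c by simp
  have "Gamma \<alpha> = \<mu> * (c * integral\<^sup>L lborel K)"
    using lborel_integral_real_affine[OF l0, of g "\<mu> * t"] gI l unfolding eq by simp
  also have "\<mu> * (c * integral\<^sup>L lborel K) = \<mu> powr \<alpha> * exp (- \<mu> * t) * integral\<^sup>L lborel K"
    using l by (simp add: c_def powr_diff)
  finally have "Gamma \<alpha> * \<mu> powr (- \<alpha>) * exp (\<mu> * t) =
      (\<mu> powr \<alpha> * \<mu> powr (- \<alpha>)) * (exp (- \<mu> * t) * exp (\<mu> * t)) * integral\<^sup>L lborel K" by simp
  also have "\<dots> = integral\<^sup>L lborel K"
    using l by (simp add: powr_add[symmetric] exp_add[symmetric])
  finally have KI: "integral\<^sup>L lborel K = Gamma \<alpha> * \<mu> powr (- \<alpha>) * exp (\<mu> * t)" by simp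
  have le: "indicator {0..t} r *\<^sub>R ((t - r) powr (\<alpha> - 1) * exp (\<mu> * r)) \<le> K r" for r
    by (auto simp: K_def indicator_def)
  have I: "integrable lborel (\<lambda>r. indicator {0..t} r *\<^sub>R ((t - r) powr (\<alpha> - 1) * exp (\<mu> * r)))"
    by (rule Bochner_Integration.integrable_bound[OF Ki]) (auto simp: K_def indicator_def)
  then show ?I by (simp add: set_integrable_def)
  show "(LINT r:{0..t}|lborel. (t - r) powr (\<alpha> - 1) * exp (\<mu> * r)) \<le> Gamma \<alpha> * \<mu> powr (- \<alpha>) * exp (\<mu> * t)"
    unfolding set_lebesgue_integral_def KI[symmetric] using I Ki le by (rule integral_mono)
qed

section \<open>From fractional integrals back to the primitive\<close>

text \<open>Fubini's theorem is used on the product of Borel measures, whereas derivatives are only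
  measurable with respect to the completed measure; this lemma mediates.\<close>

lemma lebesgue_measurable_ex_borel:
  fixes g :: "real \<Rightarrow> 'a::euclidean_space"
  assumes g: "g \<in> borel_measurable lebesgue"
  obtains h where "h \<in> borel_measurable borel" "AE x in lebesgue. g x = h x"
proof -
  have "\<exists>h. h \<in> borel_measurable borel \<and> (AE x in lebesgue. g x \<bullet> i = h x)" for i
  proof -
    have "(\<lambda>x. g x \<bullet> i) \<in> borel_measurable lebesgue" using g by simp
    from completion_ex_borel_measurable_real[OF this] show ?thesis
      by (auto intro: AE_completion)
  qed
  then obtain h where h: "\<And>i. h i \<in> borel_measurable borel" "\<And>i. AE x in lebesgue. g x \<bullet> i = h i x" by metis
  show thesis
  proof (rule that)
    show "(\<lambda>x. \<Sum>i\<in>Basis. h i x *\<^sub>R i) \<in> borel_measurable borel"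
      using h(1) by (intro borel_measurable_sum borel_measurable_scaleR) auto
    have "AE x in lebesgue. \<forall>i\<in>Basis. g x \<bullet> i = h i x"
      by (rule AE_finite_allI) (auto intro: h(2))
    then show "AE x in lebesgue. g x = (\<Sum>i\<in>Basis. h i x *\<^sub>R i)"
    proof eventually_elim
      case (elim x)
      have "g x = (\<Sum>i\<in>Basis. (g x \<bullet> i) *\<^sub>R i)" by (simp add: euclidean_representation)
      then show ?case using elim by simp
    qed
  qed
qed

text \<open>The inequality form of the passage from the Caputo equation to the integral equation: Abel
  inversion expresses the integral of \<open>y\<close> through its fractional integrals, and \<open>exponential_kernel\<close>
  evaluates the resulting bound.\<close>

lemma integral_bound_of_fractional_integral_bound:
  fixes y :: "real \<Rightarrow> 'a::euclidean_space"
  assumes \<alpha>: "0 < \<alpha>" "\<alpha> < 1" and \<mu>: "\<mu> > 0" and c: "c \<ge> 0"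
    and y: "set_integrable lebesgue {0..t} y"
    and bd: "AE r in lebesgue. r \<in> {0..t} \<longrightarrow>
      norm (LINT s:{0..r}|lebesgue. (r - s) powr (- \<alpha>) *\<^sub>R y s) \<le> c * exp (\<mu> * r)"
  shows "norm (LINT s:{0..t}|lebesgue. y s) \<le> c / Gamma (1 - \<alpha>) * \<mu> powr (- \<alpha>) * exp (\<mu> * t)"
proof -
  define y0 where "y0 = (\<lambda>s. indicator {0..t} s *\<^sub>R y s)"
  have y0i: "integrable lebesgue y0" using y by (simp add: set_integrable_def y0_def)
  then have y0m: "y0 \<in> borel_measurable lebesgue" by auto
  obtain h where h[measurable]: "h \<in> borel_measurable borel" and ae: "AE s in lebesgue. y0 s = h s"
    by (rule lebesgue_measurable_ex_borel[OF y0m])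
  have hm: "h \<in> borel_measurable lborel" using h by simp
  have hl: "h \<in> borel_measurable lebesgue" by (rule measurable_completion[OF hm])
  have "integrable lebesgue h" by (rule integrable_cong_AE_imp[OF y0i hl ae])
  then have hi: "integrable lborel h" by (simp add: integrable_completion)
  then have hsi: "set_integrable lborel {0..t} h"
    unfolding set_integrable_def by (intro integrable_mult_indicator) auto
  have frac: "(LINT s:{0..r}|lebesgue. (r - s) powr (- \<alpha>) *\<^sub>R y s) = (LINT s:{0..r}|lborel. (r - s) powr (- \<alpha>) *\<^sub>R h s)"
    if r: "r \<in> {0..t}" for r
  proof -
    have "(LINT s:{0..r}|lebesgue. (r - s) powr (- \<alpha>) *\<^sub>R y s) =
        (\<integral>s. (indicator {0..r} s * (r - s) powr (- \<alpha>)) *\<^sub>R y0 s \<partial>lebesgue)"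
      unfolding set_lebesgue_integral_def y0_def using r
      by (intro Bochner_Integration.integral_cong) (auto simp: indicator_def)
    also have "\<dots> = (\<integral>s. (indicator {0..r} s * (r - s) powr (- \<alpha>)) *\<^sub>R h s \<partial>lebesgue)"
    proof (rule integral_cong_AE)
      have "(\<lambda>s. indicator {0..r} s * (r - s) powr (- \<alpha>)) \<in> borel_measurable lborel" by measurable
      then have m: "(\<lambda>s. indicator {0..r} s * (r - s) powr (- \<alpha>)) \<in> borel_measurable lebesgue"
        by (rule measurable_completion)
      show "(\<lambda>s. (indicator {0..r} s * (r - s) powr (- \<alpha>)) *\<^sub>R y0 s) \<in> borel_measurable lebesgue"
        by (rule borel_measurable_scaleR[OF m y0m])
      show "(\<lambda>s. (indicator {0..r} s * (r - s) powr (- \<alpha>)) *\<^sub>R h s) \<in> borel_measurable lebesgue"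
        by (rule borel_measurable_scaleR[OF m hl])
      show "AE s in lebesgue. (indicator {0..r} s * (r - s) powr (- \<alpha>)) *\<^sub>R y0 s =
          (indicator {0..r} s * (r - s) powr (- \<alpha>)) *\<^sub>R h s"
        using ae by eventually_elim simp
    qed
    also have "\<dots> = (\<integral>s. (indicator {0..r} s * (r - s) powr (- \<alpha>)) *\<^sub>R h s \<partial>lborel)"
      by (rule integral_completion) measurable
    finally show ?thesis by (simp add: set_lebesgue_integral_def)
  qed
  have whole: "(LINT s:{0..t}|lebesgue. y s) = (LINT s:{0..t}|lborel. h s)"
  proof -
    have "(LINT s:{0..t}|lebesgue. y s) = integral\<^sup>L lebesgue (\<lambda>s. indicator {0..t} s *\<^sub>R y0 s)"
      unfolding set_lebesgue_integral_def y0_def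
      by (intro Bochner_Integration.integral_cong) (auto simp: indicator_def)
    also have "\<dots> = integral\<^sup>L lebesgue (\<lambda>s. indicator {0..t} s *\<^sub>R h s)"
    proof (rule integral_cong_AE)
      have m: "(\<lambda>s. indicator {0..t} s :: real) \<in> borel_measurable lebesgue" by (rule measurable_completion) measurable
      show "(\<lambda>s. indicator {0..t} s *\<^sub>R y0 s) \<in> borel_measurable lebesgue"
        by (rule borel_measurable_scaleR[OF m y0m])
      show "(\<lambda>s. indicator {0..t} s *\<^sub>R h s) \<in> borel_measurable lebesgue"
        by (rule borel_measurable_scaleR[OF m hl])
      show "AE s in lebesgue. indicator {0..t} s *\<^sub>R y0 s = indicator {0..t} s *\<^sub>R h s"
        using ae by eventually_elim simp
    qed
    also have "\<dots> = (LINT s:{0..t}|lborel. h s)"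
      unfolding set_lebesgue_integral_def by (rule integral_completion) measurable
    finally show ?thesis .
  qed
  define G where "G = (\<lambda>r. (t - r) powr (\<alpha> - 1) *\<^sub>R (LINT s:{0..r}|lborel. (r - s) powr (- \<alpha>) *\<^sub>R h s))"
  note Abel = Abel_inversion[OF \<alpha> h hsi, folded G_def]
  note K = exponential_kernel[OF \<alpha>(1) \<mu>, of t]
  have pos: "Gamma \<alpha> > 0" "Gamma (1 - \<alpha>) > 0" using \<alpha> by auto
  have "Gamma \<alpha> * Gamma (1 - \<alpha>) * norm (LINT s:{0..t}|lebesgue. y s) = norm (LINT r:{0..t}|lborel. G r)"
    unfolding Abel(2) whole using pos by simp
  also have "\<dots> \<le> (\<integral>r. norm (indicator {0..t} r *\<^sub>R G r) \<partial>lborel)"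
    unfolding set_lebesgue_integral_def by (rule integral_norm_bound)
  also have "\<dots> \<le> (\<integral>r. c * (indicator {0..t} r *\<^sub>R ((t - r) powr (\<alpha> - 1) * exp (\<mu> * r))) \<partial>lborel)"
  proof (rule integral_mono_AE)
    show "integrable lborel (\<lambda>r. norm (indicator {0..t} r *\<^sub>R G r))"
      using Abel(1) unfolding set_integrable_def by (rule integrable_norm)
    show "integrable lborel (\<lambda>r. c * (indicator {0..t} r *\<^sub>R ((t - r) powr (\<alpha> - 1) * exp (\<mu> * r))))"
      using K(1) unfolding set_integrable_def by (rule integrable_mult_right)
    have "AE r in lborel. r \<in> {0..t} \<longrightarrow>
      norm (LINT s:{0..r}|lebesgue. (r - s) powr (- \<alpha>) *\<^sub>R y s) \<le> c * exp (\<mu> * r)"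
      using bd unfolding AE_completion_iff .
    then show "AE r in lborel. norm (indicator {0..t} r *\<^sub>R G r) \<le>
        c * (indicator {0..t} r *\<^sub>R ((t - r) powr (\<alpha> - 1) * exp (\<mu> * r)))"
    proof eventually_elim
      case (elim r)
      show ?case
      proof (cases "r \<in> {0..t}")
        case True
        then have "norm (LINT s:{0..r}|lborel. (r - s) powr (- \<alpha>) *\<^sub>R h s) \<le> c * exp (\<mu> * r)"
          using elim frac[OF True] by simp
        then have "norm (G r) \<le> (t - r) powr (\<alpha> - 1) * (c * exp (\<mu> * r))"
          unfolding G_def norm_scaleR by (simp add: mult_left_mono)
        then show ?thesis using True by (simp add: mult_ac)
      qed simp
    qed
  qed
  also have "\<dots> = c * (LINT r:{0..t}|lborel. (t - r) powr (\<alpha> - 1) * exp (\<mu> * r))"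
    unfolding set_lebesgue_integral_def by (rule integral_mult_right_zero)
  also have "\<dots> \<le> c * (Gamma \<alpha> * \<mu> powr (- \<alpha>) * exp (\<mu> * t))"
    by (rule mult_left_mono[OF K(2) c])
  finally have "norm (LINT s:{0..t}|lebesgue. y s) * (Gamma \<alpha> * Gamma (1 - \<alpha>)) \<le>
     (c / Gamma (1 - \<alpha>) * \<mu> powr (- \<alpha>) * exp (\<mu> * t)) * (Gamma \<alpha> * Gamma (1 - \<alpha>))"
    using pos by (simp add: mult_ac)
  then show ?thesis using pos by (simp only: mult_le_cancel_right_pos mult_pos_pos)
qed

lemma AE_lebesgue_ex_in_interval:
  fixes a b :: real
  assumes ae: "AE t in lebesgue. P t" and ab: "a < b"
  shows "\<exists>t. a < t \<and> t < b \<and> P t"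
proof (rule ccontr)
  assume "\<nexists>t. a < t \<and> t < b \<and> P t"
  then have *: "\<not> P t" if "t \<in> {a<..<b}" for t using that by auto
  have "AE t in lebesgue. t \<notin> {a<..<b}" using ae by eventually_elim (use * in blast)
  then have "AE t in lborel. t \<notin> {a<..<b}" unfolding AE_completion_iff .
  then have "{a<..<b} \<in> null_sets lborel" by (subst AE_iff_null_sets) auto
  then show False using ab by (simp add: null_sets_def)
qed

text \<open>The weight \<open>(t' - s)\<^bsup>-\<alpha>\<^esup>\<close> is at least \<open>t'\<^bsup>-\<alpha>\<^esup>\<close> on \<open>[0, t]\<close>, so integrability
  against it is the stronger property. For a solution, this makes the derivative integrable on every
  \<open>[0, t]\<close> with \<open>t < T\<close>, because the equation holds at some \<open>t'\<close> in \<open>(t, T)\<close>.\<close>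

lemma set_integrable_of_fractional_kernel:
  fixes y :: "real \<Rightarrow> 'a::euclidean_space"
  assumes \<alpha>: "0 < \<alpha>" and t: "t < t'"
    and int: "set_integrable lebesgue {0..t'} (\<lambda>s. (t' - s) powr (- \<alpha>) *\<^sub>R y s)"
  shows "set_integrable lebesgue {0..t} y"
proof -
  define z where "z = (\<lambda>s. indicator {0..t'} s *\<^sub>R ((t' - s) powr (- \<alpha>) *\<^sub>R y s))"
  have z: "integrable lebesgue z" using int by (simp add: set_integrable_def z_def)
  have eq: "indicator {0..t} s *\<^sub>R y s = (indicator {0..t} s * (t' - s) powr \<alpha>) *\<^sub>R z s" for s
  proof (cases "s \<in> {0..t}")
    case True
    then have "(t' - s) powr \<alpha> * (t' - s) powr (- \<alpha>) = 1" using t by (simp add: powr_add[symmetric])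
    then show ?thesis using True t by (simp add: z_def)
  qed simp
  have "(\<lambda>s. indicator {0..t} s * (t' - s) powr \<alpha>) \<in> borel_measurable lborel" by measurable
  then have m: "(\<lambda>s. indicator {0..t} s * (t' - s) powr \<alpha>) \<in> borel_measurable lebesgue"
    by (rule measurable_completion)
  have "integrable lebesgue (\<lambda>s. (indicator {0..t} s * (t' - s) powr \<alpha>) *\<^sub>R z s)"
  proof (rule Bochner_Integration.integrable_bound)
    show "integrable lebesgue (\<lambda>s. t' powr \<alpha> *\<^sub>R z s)" using z by simp
    show "(\<lambda>s. (indicator {0..t} s * (t' - s) powr \<alpha>) *\<^sub>R z s) \<in> borel_measurable lebesgue"
      using m z by (intro borel_measurable_scaleR) auto
    have "indicator {0..t} s * (t' - s) powr \<alpha> \<le> t' powr \<alpha>" for s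
      using t \<alpha> by (auto simp: indicator_def intro!: powr_mono2)
    then show "AE s in lebesgue. norm ((indicator {0..t} s * (t' - s) powr \<alpha>) *\<^sub>R z s) \<le> norm (t' powr \<alpha> *\<^sub>R z s)"
      by (intro AE_I2) (auto simp: abs_mult intro!: mult_right_mono)
  qed
  then show ?thesis unfolding set_integrable_def eq .
qed

section \<open>Piecewise absolutely continuous functions\<close>

text \<open>Each piece is continuous on a half-open interval and has a limit at the missing endpoint.
  The resulting bound depends on \<open>x\<close>; it serves only to make the weighted supremum in
  \<open>weighted_sup_bound\<close> finite.\<close>

lemma piecewise_ac_bounded:
  fixes x :: "real \<Rightarrow> 'a::euclidean_space" and \<tau> :: "nat \<Rightarrow> real"
  assumes first: "abs_cont_on {0..\<tau> 1} x"
    and pieces: "\<And>k. k \<in> {1..m} \<Longrightarrow> abs_cont_on {\<tau> k<..\<tau> (k + 1)} x"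
    and right: "\<And>k. k \<in> {1..m} \<Longrightarrow> \<exists>l. (x \<longlongrightarrow> l) (at_right (\<tau> k))"
    and le: "\<And>k. k \<le> m \<Longrightarrow> \<tau> k < \<tau> (k + 1)"
  shows "bounded (x ` {0..\<tau> (m + 1)})"
proof -
  have "bounded (x ` {0..\<tau> (k + 1)})" if "k \<le> m" for k
    using that
  proof (induction k)
    case 0
    have "continuous_on {0..\<tau> 1} x"
      by (rule abs_cont_on_imp_continuous_on[OF first]) (simp add: is_interval_cc)
    then show ?case by (simp add: compact_continuous_image compact_imp_bounded)
  next
    case (Suc k)
    let ?c = "\<tau> (Suc k)" and ?d = "\<tau> (Suc k + 1)"
    have k: "Suc k \<in> {1..m}" using Suc.prems by simp
    obtain l where l: "(x \<longlongrightarrow> l) (at_right ?c)" using right[OF k] by blast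
    have "eventually (\<lambda>t. dist (x t) l < 1) (at_right ?c)" using l by (rule tendstoD) simp
    then obtain e where e: "e > ?c" "\<And>t. ?c < t \<Longrightarrow> t < e \<Longrightarrow> dist (x t) l < 1"
      unfolding eventually_at_right_field by blast
    have "continuous_on {e..?d} x"
      by (rule continuous_on_subset[OF abs_cont_on_imp_continuous_on[OF pieces[OF k]]])
        (use e in \<open>auto simp: is_interval_oc\<close>)
    then have "bounded (x ` {e..?d})" by (simp add: compact_continuous_image compact_imp_bounded)
    moreover have "bounded (x ` {0..\<tau> (k + 1)})" using Suc by simp
    ultimately have "bounded (x ` {0..\<tau> (k + 1)} \<union> ball l 1 \<union> x ` {e..?d})" by simp
    moreover have "x ` {0..?d} \<subseteq> x ` {0..\<tau> (k + 1)} \<union> ball l 1 \<union> x ` {e..?d}"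
      using e(2) by (force simp: dist_commute not_le)
    ultimately show ?case by (rule bounded_subset)
  qed
  then show ?thesis by simp
qed

text \<open>Subtracting the integral of the derivative leaves a step function, by the fundamental theorem of
  calculus on each piece. On the piece to the right of \<open>\<tau> k\<close> its value is its right limit at \<open>\<tau> k\<close>,
  and this differs from its value at \<open>\<tau> k\<close> by the jump of \<open>x\<close>, since the integral is continuous.\<close>

lemma piecewise_ac_minus_integral_bound:
  fixes x :: "real \<Rightarrow> 'a::euclidean_space" and \<tau> :: "nat \<Rightarrow> real"
  defines "y \<equiv> \<lambda>s. vector_derivative x (at s)"
  assumes first: "abs_cont_on {0..\<tau> 1} x"
    and pieces: "\<And>k. k \<in> {1..m} \<Longrightarrow> abs_cont_on {\<tau> k<..\<tau> (k + 1)} x"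
    and jump: "\<And>k. k \<in> {1..m} \<Longrightarrow> \<exists>l. (x \<longlongrightarrow> l) (at_right (\<tau> k)) \<and> norm (l - x (\<tau> k)) \<le> J"
    and le: "\<And>k. k \<le> m \<Longrightarrow> \<tau> k < \<tau> (k + 1)" and \<tau>0: "\<tau> 0 = 0" and J: "J \<ge> 0"
    and int: "y integrable_on {0..t}" and t: "0 \<le> t" "t \<le> \<tau> (m + 1)"
  shows "norm (x t - integral {0..t} y) \<le> norm (x 0) + real m * J"
proof -
  define w where "w = (\<lambda>t. x t - integral {0..t} y)"
  have int': "y integrable_on {0..s}" if "s \<le> t" for s
    by (rule integrable_subinterval_real[OF int]) (use that in auto)
  have const: "w v = w u" if "0 \<le> u" "u \<le> v" "v \<le> t" "abs_cont_on {u..v} x" for u v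
  proof -
    have "(y has_integral (x v - x u)) {u..v}"
      unfolding y_def by (rule ac_fundamental_theorem_of_calculus) (use that in auto)
    then have "integral {u..v} y = x v - x u" by (rule integral_unique)
    moreover have "integral {0..u} y + integral {u..v} y = integral {0..v} y"
      by (rule Henstock_Kurzweil_Integration.integral_combine) (use that int' in auto)
    ultimately have "integral {0..v} y = integral {0..u} y + (x v - x u)" by simp
    then show ?thesis by (simp add: w_def)
  qed
  have \<tau>pos: "0 \<le> \<tau> k" if "k \<le> m + 1" for k
    using that
  proof (induction k)
    case (Suc k) then show ?case using le[of k] by simp
  qed (simp add: \<tau>0)
  have "norm (w s) \<le> norm (x 0) + real k * J" if "k \<le> m" "0 \<le> s" "s \<le> t" "s \<le> \<tau> (k + 1)" for k s
    using that
  proof (induction k arbitrary: s)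
    case 0
    have "abs_cont_on {0..s} x" by (rule abs_cont_on_subset[OF first]) (use 0 in auto)
    then have "w s = w 0" using 0 by (intro const) auto
    then show ?case by (simp add: w_def)
  next
    case (Suc k)
    let ?c = "\<tau> (Suc k)"
    have c: "0 \<le> ?c" using Suc.prems by (intro \<tau>pos) simp
    show ?case
    proof (cases "s \<le> ?c")
      case True
      then have "norm (w s) \<le> norm (x 0) + real k * J" using Suc by simp
      then show ?thesis using J by (simp add: algebra_simps)
    next
      case False
      have k: "Suc k \<in> {1..m}" using Suc.prems by simp
      obtain l where l: "(x \<longlongrightarrow> l) (at_right ?c)" "norm (l - x ?c) \<le> J" using jump[OF k] by blast
      have wu: "w u = w s" if "u \<in> {?c<..<s}" for u
      proof (rule const[symmetric])
        show "abs_cont_on {u..s} x"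
          by (rule abs_cont_on_subset[OF pieces[OF k]]) (use that Suc.prems in auto)
      qed (use that c Suc.prems in auto)
      have "continuous_on {0..s} (\<lambda>t. integral {0..t} y)"
        by (rule indefinite_integral_continuous_1[OF int']) (use Suc.prems in simp)
      then have "((\<lambda>t. integral {0..t} y) \<longlongrightarrow> integral {0..?c} y) (at ?c within {0..s})"
        using c False by (auto simp: continuous_on_def)
      then have "((\<lambda>t. integral {0..t} y) \<longlongrightarrow> integral {0..?c} y) (at ?c within {?c..s})"
        by (rule tendsto_within_subset) (use c in auto)
      then have "((\<lambda>t. integral {0..t} y) \<longlongrightarrow> integral {0..?c} y) (at_right ?c)"
        using False by (simp add: at_within_Icc_at_right)
      then have "(w \<longlongrightarrow> l - integral {0..?c} y) (at_right ?c)"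
        unfolding w_def by (rule tendsto_diff[OF l(1)])
      moreover have "eventually (\<lambda>u. w u = w s) (at_right ?c)"
        by (rule eventually_at_rightI[of _ s]) (use wu False in auto)
      then have "(w \<longlongrightarrow> w s) (at_right ?c)" by (rule tendsto_eventually)
      ultimately have "w s = l - integral {0..?c} y"
        using tendsto_unique trivial_limit_at_right_real by blast
      also have "\<dots> = w ?c + (l - x ?c)" by (simp add: w_def)
      also have "norm \<dots> \<le> norm (w ?c) + norm (l - x ?c)" by (rule norm_triangle_ineq)
      also have "norm (w ?c) \<le> norm (x 0) + real k * J" using Suc.IH[of ?c] Suc.prems c False by simp
      finally show ?thesis using l(2) by (simp add: algebra_simps)
    qed
  qed
  from this[of m t] show ?thesis using t by (simp add: w_def)
qed

section \<open>The a priori bound\<close>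

lemma projection_field_linear_growth:
  fixes A :: "real^'n^'n" and b :: "real^'n"
  assumes K: "K \<noteq> {}" "closed K" "convex K"
  obtains C where "C > 0"
    "\<And>x. norm (- x + closest_point K (x - \<rho> *\<^sub>R (A *v x) - \<rho> *\<^sub>R b)) \<le> C * (1 + norm x)"
proof -
  define N where "N = onorm ((*v) A)"
  have N: "norm (A *v x) \<le> N * norm x" for x
    unfolding N_def by (rule onorm[OF matrix_vector_mul_bounded_linear])
  have N0: "N \<ge> 0" unfolding N_def by (rule onorm_pos_le[OF matrix_vector_mul_bounded_linear])
  define C where "C = 2 + \<bar>\<rho>\<bar> * N + \<bar>\<rho>\<bar> * norm b + norm (closest_point K 0)"
  show thesis
  proof (rule that)
    show "C > 0" unfolding C_def using N0 by (intro add_pos_nonneg) auto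
    fix x :: "real^'n"
    define v where "v = x - \<rho> *\<^sub>R (A *v x) - \<rho> *\<^sub>R b"
    have "norm v \<le> norm x + \<bar>\<rho>\<bar> * norm (A *v x) + \<bar>\<rho>\<bar> * norm b"
      unfolding v_def by (metis (no_types) add_mono norm_scaleR norm_triangle_ineq4 order_refl order_trans)
    also have "\<dots> \<le> norm x + \<bar>\<rho>\<bar> * (N * norm x) + \<bar>\<rho>\<bar> * norm b"
      by (intro add_mono mult_left_mono N) auto
    finally have v: "norm v \<le> norm x + \<bar>\<rho>\<bar> * (N * norm x) + \<bar>\<rho>\<bar> * norm b" .
    have "norm (closest_point K v - closest_point K 0) \<le> norm v"
      using closest_point_lipschitz[OF K(3,2,1), of v 0] by (simp add: dist_norm)
    then have "norm (closest_point K v) \<le> norm v + norm (closest_point K 0)"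
      using norm_triangle_sub[of "closest_point K v" "closest_point K 0"] by linarith
    then have "norm (- x + closest_point K v) \<le> norm x + norm v + norm (closest_point K 0)"
      using norm_triangle_ineq[of "- x" "closest_point K v"] by simp
    also have "\<dots> \<le> 2 * norm x + \<bar>\<rho>\<bar> * N * norm x + \<bar>\<rho>\<bar> * norm b + norm (closest_point K 0)"
      using v by (simp add: mult.assoc)
    also have "\<dots> \<le> C * (1 + norm x)"
    proof -
      have "0 \<le> 2 + \<bar>\<rho>\<bar> * N + (\<bar>\<rho>\<bar> * norm b + norm (closest_point K 0)) * norm x"
        using N0 by (intro add_nonneg_nonneg mult_nonneg_nonneg) auto
      then show ?thesis by (simp add: C_def algebra_simps)
    qed
    finally show "norm (- x + closest_point K (x - \<rho> *\<^sub>R (A *v x) - \<rho> *\<^sub>R b)) \<le> C * (1 + norm x)"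
      by (simp add: v_def)
  qed
qed

text \<open>With \<open>\<Phi>\<close> the supremum of \<open>norm (x r) * exp (- \<mu> * r)\<close>, the hypothesis \<open>step\<close> says that
  \<open>\<Phi> \<le> a + (1 + \<Phi>) / 2\<close>, and as \<open>\<Phi>\<close> is finite it can be absorbed into the left-hand side.\<close>

lemma weighted_sup_bound:
  fixes x :: "real \<Rightarrow> 'a::real_normed_vector"
  assumes T: "T \<ge> 0" and bdd: "bounded (x ` {0..T})"
    and step: "\<And>\<Phi>. \<lbrakk>\<Phi> \<ge> 0; \<And>r. r \<in> {0..T} \<Longrightarrow> norm (x r) \<le> \<Phi> * exp (\<mu> * r)\<rbrakk>
       \<Longrightarrow> \<forall>t\<in>{0..T}. norm (x t) \<le> (a + (1 + \<Phi>) / 2) * exp (\<mu> * t)"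
    and t: "t \<in> {0..T}"
  shows "norm (x t) \<le> (2 * a + 1) * exp (\<mu> * t)"
proof -
  define \<Phi> where "\<Phi> = (SUP r\<in>{0..T}. norm (x r) * exp (- \<mu> * r))"
  obtain B where B: "\<And>r. r \<in> {0..T} \<Longrightarrow> norm (x r) \<le> B" using bdd unfolding bounded_iff by blast
  have "exp (- \<mu> * r) \<le> exp (\<bar>\<mu>\<bar> * T)" if "r \<in> {0..T}" for r
  proof -
    have "- \<mu> * r \<le> \<bar>\<mu>\<bar> * r" using that by (intro mult_right_mono) auto
    also have "\<dots> \<le> \<bar>\<mu>\<bar> * T" using that by (intro mult_left_mono) auto
    finally show ?thesis by simp
  qed
  then have "norm (x r) * exp (- \<mu> * r) \<le> B * exp (\<bar>\<mu>\<bar> * T)" if "r \<in> {0..T}" for r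
    using B[OF that] that order_trans[OF norm_ge_zero B[OF that]] by (intro mult_mono) auto
  then have bddA: "bdd_above ((\<lambda>r. norm (x r) * exp (- \<mu> * r)) ` {0..T})" by (rule bdd_aboveI2)
  have le: "norm (x r) * exp (- \<mu> * r) \<le> \<Phi>" if "r \<in> {0..T}" for r
    unfolding \<Phi>_def by (rule cSUP_upper[OF that bddA])
  have weight: "norm (x r) = (norm (x r) * exp (- \<mu> * r)) * exp (\<mu> * r)" for r
    by (simp add: exp_minus)
  have x\<Phi>: "norm (x r) \<le> \<Phi> * exp (\<mu> * r)" if "r \<in> {0..T}" for r
    by (subst weight) (rule mult_right_mono[OF le[OF that]], simp)
  have \<Phi>0: "\<Phi> \<ge> 0" using le[of 0] T by (smt (verit) atLeastAtMost_iff exp_ge_zero mult_nonneg_nonneg norm_ge_zero)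
  from step[OF \<Phi>0 x\<Phi>] have st: "norm (x r) \<le> (a + (1 + \<Phi>) / 2) * exp (\<mu> * r)" if "r \<in> {0..T}" for r
    using that by blast
  have "\<Phi> \<le> a + (1 + \<Phi>) / 2" unfolding \<Phi>_def
  proof (rule cSUP_least)
    fix r assume "r \<in> {0..T}"
    from mult_right_mono[OF st[OF this], of "exp (- \<mu> * r)"]
    show "norm (x r) * exp (- \<mu> * r) \<le> a + (1 + (SUP r\<in>{0..T}. norm (x r) * exp (- \<mu> * r))) / 2"
      unfolding \<Phi>_def[symmetric] by (simp add: exp_minus mult.assoc)
  qed (use T in auto)
  then have "\<Phi> \<le> 2 * a + 1" by (simp add: field_simps)
  then have "\<Phi> * exp (\<mu> * t) \<le> (2 * a + 1) * exp (\<mu> * t)" by (intro mult_right_mono) auto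
  then show ?thesis using x\<Phi>[OF t] by linarith
qed

theorem theorem3p4:
  fixes \<alpha> T \<rho> l1 l2 :: real
    and m :: nat
    and \<tau> :: "nat \<Rightarrow> real"
    and A :: "real^'n^'n"
    and b x0 :: "real^'n"
    and K :: "(real^'n) set"
    and U :: "nat \<Rightarrow> real^'n \<Rightarrow> real^'n"
  assumes "0 < \<alpha>" and "\<alpha> < 1"
    and "0 < T"
    and "\<tau> 0 = 0" and "\<tau> (m + 1) = T" and "\<And>k. k \<le> m \<Longrightarrow> \<tau> k < \<tau> (k + 1)"
    and "K \<noteq> {}" and "closed K" and "convex K"
    and "l1 > 0" and "l2 > 0"
    and "\<And>k x. k \<in> {1..m} \<Longrightarrow> norm (U k x) \<le> l1"
    and "\<And>k x y. k \<in> {1..m} \<Longrightarrow> norm (U k x - U k y) \<le> l2 * norm (x - y)"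
  shows "\<exists>M. \<forall>x. impulsive_solution \<alpha> T m \<tau> A b \<rho> K U x0 x \<longrightarrow>
           (\<forall>t\<in>{0..T}. norm (x t) \<le> M)"
proof -
  obtain C where C: "C > 0"
    "\<And>x. norm (- x + closest_point K (x - \<rho> *\<^sub>R (A *v x) - \<rho> *\<^sub>R b)) \<le> C * (1 + norm x)"
    by (rule projection_field_linear_growth[OF assms(7-9)]) blast
  \<comment> \<open>Chosen such that \<open>C * \<mu> powr (- \<alpha>)\<close> is one half, as the absorption in \<open>weighted_sup_bound\<close> needs.\<close>
  define \<mu> where "\<mu> = (2 * C) powr (1 / \<alpha>)"
  have \<mu>: "\<mu> > 0" using C(1) by (simp add: \<mu>_def)
  have \<mu>C: "C * \<mu> powr (- \<alpha>) = 1 / 2"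
    using C(1) \<open>0 < \<alpha>\<close> by (simp add: \<mu>_def powr_powr powr_neg_one)
  define a where "a = norm x0 + real m * l1"
  have a0: "a \<ge> 0" using \<open>l1 > 0\<close> by (simp add: a_def)
  have "norm (x t) \<le> (2 * a + 1) * exp (\<mu> * T)"
    if sol: "impulsive_solution \<alpha> T m \<tau> A b \<rho> K U x0 x" and t: "t \<in> {0..T}" for x t
  proof -
    define y where "y = (\<lambda>s. vector_derivative x (at s))"
    define f where "f = (\<lambda>x. - x + closest_point K (x - \<rho> *\<^sub>R (A *v x) - \<rho> *\<^sub>R b))"
    have first: "abs_cont_on {0..\<tau> 1} x"
      and pieces: "\<And>k. k \<in> {1..m} \<Longrightarrow> abs_cont_on {\<tau> k<..\<tau> (k + 1)} x"
      and eqn: "AE t in lebesgue. t \<in> {0..T} - \<tau> ` {1..m} \<longrightarrow> has_caputo_derivative \<alpha> x (f (x t)) t"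
      and jumps: "\<forall>k\<in>{1..m}. \<exists>xminus xplus. (x \<longlongrightarrow> xminus) (at_left (\<tau> k)) \<and>
        (x \<longlongrightarrow> xplus) (at_right (\<tau> k)) \<and> xminus = x (\<tau> k) \<and> xplus - xminus = U k (x (\<tau> k))"
      and init: "x 0 = x0"
      using sol unfolding impulsive_solution_def f_def by blast+
    have jump: "\<exists>l. (x \<longlongrightarrow> l) (at_right (\<tau> k)) \<and> norm (l - x (\<tau> k)) \<le> l1" if k: "k \<in> {1..m}" for k
    proof -
      obtain l where "(x \<longlongrightarrow> l) (at_right (\<tau> k))" "l - x (\<tau> k) = U k (x (\<tau> k))"
        using jumps k by blast
      then show ?thesis using assms(12)[OF k] by auto
    qed
    have "negligible (\<tau> ` {1..m})" by (intro negligible_finite) simp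
    then have "AE t in lebesgue. t \<notin> \<tau> ` {1..m}" by (intro AE_not_in) (simp add: negligible_iff_null_sets)
    with eqn have eqn: "AE t in lebesgue. t \<in> {0..T} \<longrightarrow> has_caputo_derivative \<alpha> x (f (x t)) t"
      by eventually_elim auto
    have yint: "set_integrable lebesgue {0..t} y" if t: "0 \<le> t" "t < T" for t
    proof -
      obtain t' where t': "t < t'" "t' < T" "t' \<in> {0..T} \<longrightarrow> has_caputo_derivative \<alpha> x (f (x t')) t'"
        using AE_lebesgue_ex_in_interval[OF eqn t(2)] by blast
      then have "has_caputo_derivative \<alpha> x (f (x t')) t'" using t by auto
      then have "set_integrable lebesgue {0..t'} (\<lambda>s. (t' - s) powr (- \<alpha>) *\<^sub>R y s)"
        unfolding has_caputo_derivative_def y_def by blast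
      then show ?thesis by (rule set_integrable_of_fractional_kernel[OF \<open>0 < \<alpha>\<close> t'(1)])
    qed
    have frac: "AE r in lebesgue. r \<in> {0..T} \<longrightarrow>
      norm (LINT s:{0..r}|lebesgue. (r - s) powr (- \<alpha>) *\<^sub>R y s) \<le> Gamma (1 - \<alpha>) * (C * (1 + norm (x r)))"
      using eqn
    proof eventually_elim
      case (elim r)
      show ?case
      proof
        assume "r \<in> {0..T}"
        then have D: "f (x r) = (1 / Gamma (1 - \<alpha>)) *\<^sub>R (LINT s:{0..r}|lebesgue. (r - s) powr (- \<alpha>) *\<^sub>R y s)"
          using elim unfolding has_caputo_derivative_def y_def by blast
        have G: "Gamma (1 - \<alpha>) > 0" using \<open>\<alpha> < 1\<close> by simp
        then have "norm (LINT s:{0..r}|lebesgue. (r - s) powr (- \<alpha>) *\<^sub>R y s) = Gamma (1 - \<alpha>) * norm (f (x r))"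
          unfolding D by simp
        also have "\<dots> \<le> Gamma (1 - \<alpha>) * (C * (1 + norm (x r)))"
          using C(2)[of "x r"] G by (intro mult_left_mono) (auto simp: f_def)
        finally show "norm (LINT s:{0..r}|lebesgue. (r - s) powr (- \<alpha>) *\<^sub>R y s) \<le> Gamma (1 - \<alpha>) * (C * (1 + norm (x r)))" .
      qed
    qed
    have right: "\<exists>l. (x \<longlongrightarrow> l) (at_right (\<tau> k))" if "k \<in> {1..m}" for k
      using jump[OF that] by blast
    have "bounded (x ` {0..\<tau> (m + 1)})"
      by (rule piecewise_ac_bounded[OF first pieces right assms(6)])
    then have bdd: "bounded (x ` {0..T})" unfolding assms(5) .
    have step: "\<forall>t\<in>{0..T}. norm (x t) \<le> (a + (1 + \<Phi>) / 2) * exp (\<mu> * t)"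
      if \<Phi>: "\<Phi> \<ge> 0" and x\<Phi>: "\<And>r. r \<in> {0..T} \<Longrightarrow> norm (x r) \<le> \<Phi> * exp (\<mu> * r)" for \<Phi>
    proof -
      have inside: "norm (x t) \<le> (a + (1 + \<Phi>) / 2) * exp (\<mu> * t)" if t: "0 \<le> t" "t < T" for t
      proof -
        define c where "c = Gamma (1 - \<alpha>) * (C * (1 + \<Phi>))"
        have G: "Gamma (1 - \<alpha>) > 0" using \<open>\<alpha> < 1\<close> by simp
        have c: "c \<ge> 0" using G C(1) \<Phi> by (simp add: c_def)
        have "AE r in lebesgue. r \<in> {0..t} \<longrightarrow>
          norm (LINT s:{0..r}|lebesgue. (r - s) powr (- \<alpha>) *\<^sub>R y s) \<le> c * exp (\<mu> * r)"
          using frac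
        proof eventually_elim
          case (elim r)
          show ?case
          proof
            assume r: "r \<in> {0..t}"
            have "1 + norm (x r) \<le> exp (\<mu> * r) + \<Phi> * exp (\<mu> * r)"
              using x\<Phi>[of r] r t \<mu> by (intro add_mono) auto
            then have "1 + norm (x r) \<le> (1 + \<Phi>) * exp (\<mu> * r)" by (simp add: algebra_simps)
            then have "Gamma (1 - \<alpha>) * (C * (1 + norm (x r))) \<le> Gamma (1 - \<alpha>) * (C * ((1 + \<Phi>) * exp (\<mu> * r)))"
              using G C(1) by (intro mult_left_mono) auto
            then show "norm (LINT s:{0..r}|lebesgue. (r - s) powr (- \<alpha>) *\<^sub>R y s) \<le> c * exp (\<mu> * r)"
              using elim r t by (simp add: c_def mult.assoc)
          qed
        qed
        from integral_bound_of_fractional_integral_bound[OF assms(1,2) \<mu> c yint[OF t] this]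
        have "norm (LINT s:{0..t}|lebesgue. y s) \<le> (C * \<mu> powr (- \<alpha>)) * (1 + \<Phi>) * exp (\<mu> * t)"
          using G by (simp add: c_def mult_ac)
        then have I: "norm (integral {0..t} y) \<le> (1 + \<Phi>) / 2 * exp (\<mu> * t)"
          unfolding \<mu>C set_lebesgue_integral_eq_integral(2)[OF yint[OF t]] by simp
        have "norm (x t - integral {0..t} y) \<le> norm (x 0) + real m * l1"
          unfolding y_def
        proof (rule piecewise_ac_minus_integral_bound[OF first pieces jump assms(6,4)])
          show "(\<lambda>s. vector_derivative x (at s)) integrable_on {0..t}"
            using set_lebesgue_integral_eq_integral(1)[OF yint[OF t]] unfolding y_def .
          show "t \<le> \<tau> (m + 1)" using t unfolding assms(5) by simp
        qed (use t \<open>l1 > 0\<close> in simp_all)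
        then have "norm (x t - integral {0..t} y) \<le> a * 1" by (simp add: a_def init)
        also have "\<dots> \<le> a * exp (\<mu> * t)" using a0 \<mu> t by (intro mult_left_mono) auto
        finally have "norm (x t) \<le> a * exp (\<mu> * t) + (1 + \<Phi>) / 2 * exp (\<mu> * t)"
          using I norm_triangle_sub[of "x t" "integral {0..t} y"] by linarith
        then show ?thesis unfolding distrib_right .
      qed
      \<comment> \<open>The derivative is known to be integrable only on \<open>[0, t]\<close> with \<open>t < T\<close>; the endpoint \<open>T\<close> is
        reached by left-continuity.\<close>
      have last: "abs_cont_on {\<tau> m<..T} x"
      proof (cases "m = 0")
        case True
        then have "\<tau> m = 0" "\<tau> 1 = T" using assms(4,5) by simp_all
        then show ?thesis by (intro abs_cont_on_subset[OF first]) auto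
      next
        case False
        then show ?thesis using pieces[of m] assms(5) by simp
      qed
      have \<tau>m: "\<tau> m < T" using assms(6)[of m] assms(5) by simp
      have "continuous_on {\<tau> m<..T} x"
        by (rule abs_cont_on_imp_continuous_on[OF last]) (simp add: is_interval_oc)
      then have "(x \<longlongrightarrow> x T) (at T within {\<tau> m<..T})" using \<tau>m by (auto simp: continuous_on_def)
      then have "(x \<longlongrightarrow> x T) (at T within {(\<tau> m + T) / 2..T})"
        by (rule tendsto_within_subset) (use \<tau>m in auto)
      then have lim: "(x \<longlongrightarrow> x T) (at_left T)" using \<tau>m by (simp add: at_within_Icc_at_left)
      have atT: "norm (x T) \<le> (a + (1 + \<Phi>) / 2) * exp (\<mu> * T)"
      proof (rule tendsto_le[OF trivial_limit_at_left_real])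
        show "((\<lambda>t. norm (x t)) \<longlongrightarrow> norm (x T)) (at_left T)" by (intro tendsto_norm lim)
        show "((\<lambda>t. (a + (1 + \<Phi>) / 2) * exp (\<mu> * t)) \<longlongrightarrow> (a + (1 + \<Phi>) / 2) * exp (\<mu> * T)) (at_left T)"
          by (intro tendsto_intros)
        show "eventually (\<lambda>t. norm (x t) \<le> (a + (1 + \<Phi>) / 2) * exp (\<mu> * t)) (at_left T)"
          by (rule eventually_at_leftI[OF _ \<open>0 < T\<close>]) (use inside in auto)
      qed
      show ?thesis
      proof
        fix t assume "t \<in> {0..T}"
        then consider "t = T" | "0 \<le> t" "t < T" by fastforce
        then show "norm (x t) \<le> (a + (1 + \<Phi>) / 2) * exp (\<mu> * t)" using inside atT by cases auto
      qed
    qed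
    have "norm (x t) \<le> (2 * a + 1) * exp (\<mu> * t)"
      by (rule weighted_sup_bound[OF _ bdd step t]) (use \<open>0 < T\<close> in auto)
    also have "\<dots> \<le> (2 * a + 1) * exp (\<mu> * T)"
      using a0 \<mu> t by (intro mult_left_mono) auto
    finally show ?thesis .
  qed
  then show ?thesis by blast
qed

end
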